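(* Let $\mathcal M=(M,<,+,\cdot,\ldots)$ be an o-minimal expansion of a real closed field. Let $G$ be a definable group (with its definable manifold topology), let $V$ be a definable set and let $\alpha\colon G\times V\to V$ be a definable transitive action. Let $\tau$ be a topology on $V$ such that $(V,\tau)$ is a definable manifold and $\alpha$ is continuous. Let $v\in V$. Then the continuous map $\gamma\colon G\to(V,\tau)$, $\gamma(g)=\alpha(g,v)$, is an open map.
   Context: "Definable" means first-order definable in $\mathcal M$ with parameters. A definable manifold of dimension $n$ is a definable set with a topology admitting a finite cover by definable open sets definably homeomorphic to open subsets of $M^n$. A definable group is a definable set with a definable group operation; its definable manifold topology is the unique topology making it a topological group and a definable manifold of dimension $\dim G$. Such a topology $\tau$ on $V$ as in the statement exists for every definable transitive action. *)

theory Defs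
  imports "HOL-Analysis.Analysis" "HOL-Algebra.Group" "HOL-Computational_Algebra.Polynomial"
begin

definition real_closed_field :: "'m::linordered_field itself \<Rightarrow> bool" where
  "real_closed_field _ \<longleftrightarrow>
     (\<forall>x::'m. 0 \<le> x \<longrightarrow> (\<exists>y. y * y = x)) \<and>
     (\<forall>p::'m poly. odd (degree p) \<longrightarrow> (\<exists>x. poly p x = 0))"

section \<open>Structures on M (van den Dries axioms), M^n as lists of length n\<close>

definition Mn :: "nat \<Rightarrow> 'm list set" where
  "Mn n = {xs. length xs = n}"

text \<open>S n is the collection of definable (with parameters) subsets of M^n.\<close>
definition sstructure :: "(nat \<Rightarrow> 'm list set set) \<Rightarrow> bool" where
  "sstructure S \<longleftrightarrow>
     (\<forall>n. \<forall>A\<in>S n. A \<subseteq> Mn n) \<and>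
     (\<forall>n. Mn n \<in> S n) \<and>
     (\<forall>n. \<forall>A\<in>S n. \<forall>B\<in>S n. A \<union> B \<in> S n \<and> A - B \<in> S n) \<and>
     (\<forall>n A. A \<in> S n \<longrightarrow>
        {xs @ [y] | xs y. xs \<in> A} \<in> S (Suc n) \<and> {y # xs | xs y. xs \<in> A} \<in> S (Suc n)) \<and>
     (\<forall>n i j. i < n \<longrightarrow> j < n \<longrightarrow> {xs \<in> Mn n. xs ! i = xs ! j} \<in> S n) \<and>
     (\<forall>n A. A \<in> S (Suc n) \<longrightarrow> butlast ` A \<in> S n)"

text \<open>An o-minimal expansion of the ordered field M (with parameters: all points definable).\<close>
definition o_minimal_expansion :: "(nat \<Rightarrow> 'm::linordered_field list set set) \<Rightarrow> bool" where
  "o_minimal_expansion S \<longleftrightarrow>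
     sstructure S \<and>
     (\<forall>a. {[a]} \<in> S 1) \<and>
     {[x, y] | x y. x < y} \<in> S 2 \<and>
     {[x, y, x + y] | x y. True} \<in> S 3 \<and>
     {[x, y, x * y] | x y. True} \<in> S 3 \<and>
     (\<forall>A\<in>S 1. \<exists>F. finite F \<and> hd ` A = \<Union>F \<and>
        (\<forall>I\<in>F. (\<exists>a. I = {a}) \<or> (\<exists>a b. I = {a<..<b}) \<or> (\<exists>a. I = {a<..}) \<or>
                 (\<exists>b. I = {..<b}) \<or> I = UNIV))"

definition def_map :: "(nat \<Rightarrow> 'm list set set) \<Rightarrow> nat \<Rightarrow> nat \<Rightarrow> 'm list set \<Rightarrow> ('m list \<Rightarrow> 'm list) \<Rightarrow> bool" where
  "def_map S n k X f \<longleftrightarrow> X \<in> S n \<and> (\<forall>x\<in>X. f x \<in> Mn k) \<and> {x @ f x | x. x \<in> X} \<in> S (n + k)"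

definition Mbox :: "'m::linorder list \<Rightarrow> 'm list \<Rightarrow> 'm list set" where
  "Mbox a b = {xs. length xs = length a \<and> (\<forall>i<length a. a ! i < xs ! i \<and> xs ! i < b ! i)}"

definition Mtop :: "nat \<Rightarrow> 'm::linorder list topology" where
  "Mtop d = topology_generated_by {Mbox a b | a b. length a = d \<and> length b = d}"

definition def_manifold :: "(nat \<Rightarrow> 'm::linordered_field list set set) \<Rightarrow> nat \<Rightarrow> 'm list topology \<Rightarrow> 'm list set \<Rightarrow> nat \<Rightarrow> bool" where
  "def_manifold S n T X d \<longleftrightarrow> X \<in> S n \<and> topspace T = X \<and>
     (\<exists>(I::nat set) U W \<phi>. finite I \<and> X = (\<Union>i\<in>I. U i) \<and>
        (\<forall>i\<in>I. openin T (U i) \<and> U i \<in> S n \<and> W i \<in> S d \<and> openin (Mtop d) (W i) \<and>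
                def_map S n d (U i) (\<phi> i) \<and>
                homeomorphic_map (subtopology T (U i)) (subtopology (Mtop d) (W i)) (\<phi> i)))"

definition grp :: "'m list set \<Rightarrow> ('m list \<Rightarrow> 'm list \<Rightarrow> 'm list) \<Rightarrow> 'm list \<Rightarrow> 'm list monoid" where
  "grp G m e = \<lparr>carrier = G, monoid.mult = m, one = e\<rparr>"

definition def_group :: "(nat \<Rightarrow> 'm::linordered_field list set set) \<Rightarrow> nat \<Rightarrow> 'm list set \<Rightarrow> ('m list \<Rightarrow> 'm list \<Rightarrow> 'm list) \<Rightarrow> 'm list \<Rightarrow> bool" where
  "def_group S n G gmul e \<longleftrightarrow> G \<in> S n \<and> group (grp G gmul e) \<and>
     def_map S (n + n) n {g @ h | g h. g \<in> G \<and> h \<in> G} (\<lambda>xs. gmul (take n xs) (drop n xs))"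

definition def_group_topology :: "(nat \<Rightarrow> 'm::linordered_field list set set) \<Rightarrow> nat \<Rightarrow> 'm list set \<Rightarrow> ('m list \<Rightarrow> 'm list \<Rightarrow> 'm list) \<Rightarrow> 'm list \<Rightarrow> 'm list topology \<Rightarrow> bool" where
  "def_group_topology S n G gmul e T \<longleftrightarrow>
     (\<exists>d. def_manifold S n T G d) \<and>
     continuous_map (prod_topology T T) T (\<lambda>(g, h). gmul g h) \<and>
     continuous_map T T (\<lambda>g. inv\<^bsub>grp G gmul e\<^esub> g)"

definition def_transitive_action :: "(nat \<Rightarrow> 'm::linordered_field list set set) \<Rightarrow> nat \<Rightarrow> nat \<Rightarrow> 'm list set \<Rightarrow> ('m list \<Rightarrow> 'm list \<Rightarrow> 'm list) \<Rightarrow> 'm list \<Rightarrow> 'm list set \<Rightarrow> ('m list \<Rightarrow> 'm list \<Rightarrow> 'm list) \<Rightarrow> bool" where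
  "def_transitive_action S n k G gmul e V \<alpha> \<longleftrightarrow>
     V \<in> S k \<and>
     def_map S (n + k) k {g @ x | g x. g \<in> G \<and> x \<in> V} (\<lambda>xs. \<alpha> (take n xs) (drop n xs)) \<and>
     (\<forall>g\<in>G. \<forall>x\<in>V. \<alpha> g x \<in> V) \<and>
     (\<forall>x\<in>V. \<alpha> e x = x) \<and>
     (\<forall>g\<in>G. \<forall>h\<in>G. \<forall>x\<in>V. \<alpha> (gmul g h) x = \<alpha> g (\<alpha> h x)) \<and>
     (\<forall>x\<in>V. \<forall>y\<in>V. \<exists>g\<in>G. \<alpha> g x = y)"

end

theory Submission
  imports Defs
begin

text \<open>
  A definable relation over a box of \<open>M\<^sup>d\<close> with nonempty fibres in \<open>M\<close> meets, over some smaller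
  box, a constant interval of any prescribed length. In dimension one, take fibrewise infima: either
  one value is attained infinitely often, or infinitely many values are attained and fill a short
  interval. This single statement replaces cell decomposition and definable choice: it shows that a
  finite definable cover of a box has a member containing a box, that a positive definable quantity
  is bounded below by a positive constant on a smaller box, and hence that a definable relation
  \<open>R \<subseteq> B \<times> M\<^sup>m\<close> with nonempty fibres has a point \<open>(x, w)\<close> such that every neighbourhood of \<open>w\<close> meets
  the fibres over a neighbourhood of \<open>x\<close>; otherwise the failure would occur with a uniform \<open>\<epsilon>\<close> over
  a box whose fibres stay \<open>\<epsilon>/2\<close>-close to each other. Applied, in charts, to the pairs \<open>(\<gamma>(g), g)\<close>,
  this makes the orbit map open at one point, and by homogeneity everywhere.
\<close>

section \<open>Definability calculus\<close>

locale o_minimal =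
  fixes S :: "nat \<Rightarrow> 'm::linordered_field list set set"
  assumes o_minimal: "o_minimal_expansion S"
begin

lemma str: "sstructure S"
  using o_minimal by (simp add: o_minimal_expansion_def)

lemma S_subset: "A \<in> S n \<Longrightarrow> A \<subseteq> Mn n"
  using str by (auto simp: sstructure_def)

lemma S_length: "A \<in> S n \<Longrightarrow> x \<in> A \<Longrightarrow> length x = n"
  using S_subset[of A n] by (auto simp: Mn_def)

lemma S_Mn: "Mn n \<in> S n"
  using str by (simp add: sstructure_def)

lemma S_Diff: "A \<in> S n \<Longrightarrow> B \<in> S n \<Longrightarrow> A - B \<in> S n"
  using str by (simp add: sstructure_def)

lemma S_Int: "A \<in> S n \<Longrightarrow> B \<in> S n \<Longrightarrow> A \<inter> B \<in> S n"
  using S_Diff[of A n "A - B"] S_Diff[of A n B] by (simp add: Diff_Diff_Int)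

lemma S_snoc: "A \<in> S n \<Longrightarrow> {xs @ [y] | xs y. xs \<in> A} \<in> S (Suc n)"
  using str unfolding sstructure_def by blast

lemma S_Cons: "A \<in> S n \<Longrightarrow> {y # xs | xs y. xs \<in> A} \<in> S (Suc n)"
  using str unfolding sstructure_def by blast

lemma S_diagonal: "i < n \<Longrightarrow> j < n \<Longrightarrow> {xs \<in> Mn n. xs ! i = xs ! j} \<in> S n"
  using str unfolding sstructure_def by blast

lemma S_butlast: "A \<in> S (Suc n) \<Longrightarrow> butlast ` A \<in> S n"
  using str unfolding sstructure_def by blast

section \<open>Cylinders over definable sets and projections of them\<close>

lemma S_append_left:
  assumes "A \<in> S n"
  shows "{ys @ zs | ys zs. length ys = N \<and> zs \<in> A} \<in> S (N + n)"
proof (induction N)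
  case 0
  have "{ys @ zs | ys zs. length ys = 0 \<and> zs \<in> A} = A" by auto
  then show ?case using assms by simp
next
  case (Suc N)
  have "{ys @ zs | ys zs. length ys = Suc N \<and> zs \<in> A}
      = {y # xs | xs y. xs \<in> {ys @ zs | ys zs. length ys = N \<and> zs \<in> A}}" (is "?L = ?R")
  proof
    show "?L \<subseteq> ?R"
    proof
      fix x assume "x \<in> ?L"
      then obtain ys zs where x: "x = ys @ zs" "length ys = Suc N" "zs \<in> A" by blast
      then obtain u us where "ys = u # us" by (cases ys) auto
      with x have "x = u # (us @ zs)" "length us = N" "zs \<in> A" by auto
      then show "x \<in> ?R" by blast
    qed
    show "?R \<subseteq> ?L"
    proof
      fix x assume "x \<in> ?R"
      then obtain y ys zs where "x = y # (ys @ zs)" "length ys = N" "zs \<in> A" by blast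
      then have "x = (y # ys) @ zs" "length (y # ys) = Suc N" "zs \<in> A" by auto
      then show "x \<in> ?L" by blast
    qed
  qed
  then show ?case using S_Cons[OF Suc] by simp
qed

lemma S_append_right:
  assumes "A \<in> S n"
  shows "{zs @ ys | zs ys. length ys = N \<and> zs \<in> A} \<in> S (n + N)"
proof (induction N)
  case 0
  have "{zs @ ys | zs ys. length ys = 0 \<and> zs \<in> A} = A" by auto
  then show ?case using assms by simp
next
  case (Suc N)
  have "{zs @ ys | zs ys. length ys = Suc N \<and> zs \<in> A}
      = {xs @ [y] | xs y. xs \<in> {zs @ ys | zs ys. length ys = N \<and> zs \<in> A}}" (is "?L = ?R")
  proof
    show "?L \<subseteq> ?R"
    proof
      fix x assume "x \<in> ?L"
      then obtain zs ys where x: "x = zs @ ys" "length ys = Suc N" "zs \<in> A" by blast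
      then obtain us u where "ys = us @ [u]" by (metis length_Suc_conv_rev)
      with x have "x = (zs @ us) @ [u]" "length us = N" "zs \<in> A" by auto
      then show "x \<in> ?R" by blast
    qed
    show "?R \<subseteq> ?L"
    proof
      fix x assume "x \<in> ?R"
      then obtain y ys zs where "x = (zs @ ys) @ [y]" "length ys = N" "zs \<in> A" by blast
      then have "x = zs @ (ys @ [y])" "length (ys @ [y]) = Suc N" "zs \<in> A" by auto
      then show "x \<in> ?L" by blast
    qed
  qed
  then show ?case using S_snoc[OF Suc] by simp
qed

lemma S_take: "A \<in> S (N + n) \<Longrightarrow> take N ` A \<in> S N"
proof (induction n arbitrary: A)
  case 0
  have "take N x = x" if "x \<in> A" for x using S_length[OF 0 that] by simp
  then have "take N ` A = A" by force
  then show ?case using 0 by simp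
next
  case (Suc n)
  have "take N (butlast x) = take N x" if "x \<in> A" for x
    using S_length[OF Suc.prems that] by (simp add: take_butlast)
  then have "take N ` A = take N ` (butlast ` A)" by (force simp: image_image)
  then show ?case using Suc.IH[of "butlast ` A"] S_butlast[of A "N + n"] Suc.prems by simp
qed

text \<open>A formula is a predicate on valuations \<^term>\<open>s :: nat \<Rightarrow> 'm\<close> that depends on finitely many
  of the variables \<^term>\<open>s i\<close>; binding a variable shifts the others as for de Bruijn indices.\<close>

definition dep :: "nat \<Rightarrow> ((nat \<Rightarrow> 'm) \<Rightarrow> bool) \<Rightarrow> bool" where
  "dep n P \<longleftrightarrow> (\<forall>s t. (\<forall>i<n. s i = t i) \<longrightarrow> P s = P t)"

definition ext :: "nat \<Rightarrow> ((nat \<Rightarrow> 'm) \<Rightarrow> bool) \<Rightarrow> 'm list set" where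
  "ext n P = {xs \<in> Mn n. P (nth xs)}"

text \<open>The bound n on the free variables is hidden in the existential quantifier, so that the
  rules below need no arity bookkeeping. By \<open>ext_S\<close> every other valid bound yields a
  definable set too.\<close>

definition dfn :: "((nat \<Rightarrow> 'm) \<Rightarrow> bool) \<Rightarrow> bool" where
  "dfn P \<longleftrightarrow> (\<exists>n. dep n P \<and> ext n P \<in> S n)"

lemma dep_mono: "dep n P \<Longrightarrow> n \<le> m \<Longrightarrow> dep m P"
  unfolding dep_def using less_le_trans by blast

lemma depD: "dep n P \<Longrightarrow> (\<And>i. i < n \<Longrightarrow> s i = t i) \<Longrightarrow> P s = P t"
  unfolding dep_def by blast

lemma dep_comb:
  assumes "dep n P" "dep n Q"
  shows "dep n (\<lambda>s. f (P s) (Q s))"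
  unfolding dep_def
  by (intro allI impI arg_cong2[where f = f] depD[OF assms(1)] depD[OF assms(2)]) simp_all

lemma ext_mono:
  assumes "dep n P" "ext n P \<in> S n" "n \<le> m"
  shows "ext m P \<in> S m"
proof -
  have "ext m P = {zs @ ys | zs ys. length ys = m - n \<and> zs \<in> ext n P}" (is "_ = ?R")
  proof
    show "ext m P \<subseteq> ?R"
    proof
      fix x assume "x \<in> ext m P"
      then have x: "length x = m" "P (nth x)" by (auto simp: ext_def Mn_def)
      have "P (nth (take n x)) = P (nth x)" by (rule depD[OF assms(1)]) simp
      then have "take n x \<in> ext n P" using x assms(3) by (auto simp: ext_def Mn_def)
      moreover have "x = take n x @ drop n x" "length (drop n x) = m - n" using x by auto
      ultimately show "x \<in> ?R" by blast
    qed
    show "?R \<subseteq> ext m P"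
    proof
      fix x assume "x \<in> ?R"
      then obtain zs ys where x: "x = zs @ ys" "length ys = m - n" "zs \<in> ext n P" by blast
      then have l: "length zs = n" "P (nth zs)" by (auto simp: ext_def Mn_def)
      then have "P (nth x) = P (nth zs)" unfolding x by (intro depD[OF assms(1)]) (simp add: nth_append)
      then show "x \<in> ext m P" using x l assms(3) by (auto simp: ext_def Mn_def)
    qed
  qed
  then show ?thesis using S_append_right[OF assms(2), of "m - n"] assms(3) by simp
qed

text \<open>A larger arity \<open>N\<close> is reached by taking a cylinder. Projecting back to m
  coordinates recovers \<open>ext m P\<close>, because P ignores the coordinates from m on.\<close>

lemma ext_S:
  assumes "dfn P" "dep m P"
  shows "ext m P \<in> S m"
proof -
  obtain n where n: "dep n P" "ext n P \<in> S n" using assms(1) by (auto simp: dfn_def)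
  define N where "N = max n m"
  have N: "ext N P \<in> S N" using ext_mono[OF n] by (simp add: N_def)
  have "ext m P = take m ` ext N P"
  proof
    show "ext m P \<subseteq> take m ` ext N P"
    proof
      fix x assume "x \<in> ext m P"
      then have x: "length x = m" "P (nth x)" by (auto simp: ext_def Mn_def)
      \<comment> \<open>The padding value 0 is arbitrary: P does not see these coordinates.\<close>
      define z where "z = x @ replicate (N - m) 0"
      have "P (nth z) = P (nth x)" by (rule depD[OF assms(2)]) (simp add: x z_def nth_append)
      then have "z \<in> ext N P" using x by (auto simp: ext_def Mn_def z_def N_def)
      moreover have "x = take m z" using x by (simp add: z_def)
      ultimately show "x \<in> take m ` ext N P" by blast
    qed
    show "take m ` ext N P \<subseteq> ext m P"
    proof
      fix x assume "x \<in> take m ` ext N P"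
      then obtain z where z: "x = take m z" "length z = N" "P (nth z)"
        by (auto simp: ext_def Mn_def)
      have "P (nth x) = P (nth z)" unfolding z by (rule depD[OF assms(2)]) simp
      then show "x \<in> ext m P" using z by (auto simp: ext_def Mn_def N_def)
    qed
  qed
  then show ?thesis using S_take[of "ext N P" m "N - m"] N by (simp add: N_def)
qed

lemma dfn_obtain2:
  assumes "dfn P" "dfn Q"
  obtains n where "dep n P" "ext n P \<in> S n" "dep n Q" "ext n Q \<in> S n"
proof -
  obtain k m where k: "dep k P" "ext k P \<in> S k" and m: "dep m Q" "ext m Q \<in> S m"
    using assms by (auto simp: dfn_def)
  have l: "k \<le> max k m" "m \<le> max k m" by simp_all
  show ?thesis
    by (rule that[OF dep_mono[OF k(1) l(1)] ext_mono[OF k l(1)] dep_mono[OF m(1) l(2)] ext_mono[OF m l(2)]])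
qed

section \<open>Closure of formulas under connectives, renaming and quantifiers\<close>

lemma dfn_not: "dfn P \<Longrightarrow> dfn (\<lambda>s. \<not> P s)"
proof -
  assume "dfn P"
  then obtain n where n: "dep n P" "ext n P \<in> S n" by (auto simp: dfn_def)
  have "ext n (\<lambda>s. \<not> P s) = Mn n - ext n P" by (auto simp: ext_def)
  moreover have "dep n (\<lambda>s. \<not> P s)" by (rule dep_comb[OF n(1) n(1)])
  ultimately show ?thesis using S_Diff[OF S_Mn n(2)] by (auto simp: dfn_def)
qed

lemma dfn_conj: "dfn P \<Longrightarrow> dfn Q \<Longrightarrow> dfn (\<lambda>s. P s \<and> Q s)"
proof (erule dfn_obtain2, assumption)
  fix n assume n: "dep n P" "ext n P \<in> S n" "dep n Q" "ext n Q \<in> S n"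
  have "ext n (\<lambda>s. P s \<and> Q s) = ext n P \<inter> ext n Q" by (auto simp: ext_def)
  moreover have "dep n (\<lambda>s. P s \<and> Q s)" by (rule dep_comb[OF n(1,3)])
  ultimately show ?thesis using S_Int[OF n(2,4)] by (auto simp: dfn_def)
qed

lemma dfn_disj: "dfn P \<Longrightarrow> dfn Q \<Longrightarrow> dfn (\<lambda>s. P s \<or> Q s)"
  using dfn_not[OF dfn_conj[OF dfn_not[of P] dfn_not[of Q]]] by simp

lemma dfn_imp: "dfn P \<Longrightarrow> dfn Q \<Longrightarrow> dfn (\<lambda>s. P s \<longrightarrow> Q s)"
  using dfn_disj[OF dfn_not[of P], of Q] by simp

lemma dfn_const: "dfn (\<lambda>s. P)"
proof -
  have "ext 0 (\<lambda>s. True) = Mn 0" by (auto simp: ext_def)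
  then have "ext 0 (\<lambda>s. True) \<in> S 0" using S_Mn[of 0] by simp
  then have "dfn (\<lambda>s. True)" unfolding dfn_def dep_def by blast
  then show ?thesis using dfn_not[of "\<lambda>s. True"] by (cases P) auto
qed

lemma dfn_all_less: "(\<And>i. i < (d::nat) \<Longrightarrow> dfn (P i)) \<Longrightarrow> dfn (\<lambda>s. \<forall>i<d. P i s)"
proof (induction d)
  case 0
  then show ?case using dfn_const[of True] by simp
next
  case (Suc d)
  then show ?case using dfn_conj[of "P d" "\<lambda>s. \<forall>i<d. P i s"] by (simp add: All_less_Suc)
qed

lemma dfn_bex_finite: "finite I \<Longrightarrow> (\<And>i. i \<in> I \<Longrightarrow> dfn (P i)) \<Longrightarrow> dfn (\<lambda>s. \<exists>i\<in>I. P i s)"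
proof (induction I rule: finite_induct)
  case empty
  then show ?case using dfn_const[of False] by simp
next
  case (insert i I)
  have "dfn (\<lambda>s. P i s \<or> (\<exists>i\<in>I. P i s))"
    by (rule dfn_disj[OF insert.prems[of i] insert.IH[OF insert.prems]]) auto
  then show ?case by (simp only: bex_simps)
qed

text \<open>The factor \<open>Mn n\<close> gives the right meaning to the empty intersection, which
  would otherwise contain lists of every length.\<close>

lemma S_Int_finite: "(\<And>i. i < (k::nat) \<Longrightarrow> A i \<in> S n) \<Longrightarrow> Mn n \<inter> (\<Inter>i<k. A i) \<in> S n"
proof (induction k)
  case 0
  have "Mn n \<inter> (\<Inter>i<0. A i) = Mn n" by simp
  then show ?case by (simp only: S_Mn)
next
  case (Suc k)
  have "Mn n \<inter> (\<Inter>i<Suc k. A i) = (Mn n \<inter> (\<Inter>i<k. A i)) \<inter> A k"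
    unfolding lessThan_Suc by blast
  also have "\<dots> \<in> S n" by (rule S_Int[OF Suc.IH[OF Suc.prems] Suc.prems]) simp_all
  finally show ?case .
qed

text \<open>Renaming is a projection: append n coordinates that hold a tuple of
  \<open>ext n P\<close>, force coordinate \<open>N + i\<close> to equal coordinate
  \<open>f i\<close> by diagonals, and keep the first \<open>N\<close> coordinates. Hence f may be
  any map, injective or not.\<close>

lemma dfn_rename:
  assumes "dfn P"
  shows "dfn (\<lambda>s. P (\<lambda>i. s (f i)))"
proof -
  obtain n where n: "dep n P" "ext n P \<in> S n" using assms by (auto simp: dfn_def)
  obtain N where N: "\<And>i. i < n \<Longrightarrow> f i < N"
  proof -
    have "finite (f ` {..<n})" by simp
    then obtain N where "\<forall>x\<in>f ` {..<n}. x < N"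
      using finite_nat_set_iff_bounded by blast
    then show ?thesis using that by auto
  qed
  define C where "C = {ys @ zs | ys zs. length ys = N \<and> zs \<in> ext n P}"
  define E where "E = (\<lambda>i. {xs::'m list. xs \<in> Mn (N + n) \<and> xs ! (N + i) = xs ! f i})"
  define X where "X = C \<inter> (Mn (N + n) \<inter> (\<Inter>i<n. E i))"
  have X: "X \<in> S (N + n)"
    unfolding X_def
  proof (rule S_Int)
    show "C \<in> S (N + n)" unfolding C_def by (rule S_append_left[OF n(2)])
    have "E i \<in> S (N + n)" if "i < n" for i
      unfolding E_def using N[OF that] that by (intro S_diagonal) auto
    then show "Mn (N + n) \<inter> (\<Inter>i<n. E i) \<in> S (N + n)" by (rule S_Int_finite)
  qed
  have "ext N (\<lambda>s. P (\<lambda>i. s (f i))) = take N ` X"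
  proof
    show "ext N (\<lambda>s. P (\<lambda>i. s (f i))) \<subseteq> take N ` X"
    proof
      fix x assume "x \<in> ext N (\<lambda>s. P (\<lambda>i. s (f i)))"
      then have x: "length x = N" "P (\<lambda>i. x ! f i)" by (auto simp: ext_def Mn_def)
      define z where "z = map (\<lambda>i. x ! f i) [0..<n]"
      have "P (nth z) = P (\<lambda>i. x ! f i)" by (rule depD[OF n(1)]) (simp add: z_def)
      then have "z \<in> ext n P" using x by (simp add: ext_def Mn_def z_def)
      then have "x @ z \<in> C" using x by (auto simp: C_def)
      moreover have "x @ z \<in> E i" if "i < n" for i
        using N[OF that] that x by (simp add: E_def Mn_def z_def nth_append)
      moreover have "x @ z \<in> Mn (N + n)" using x by (simp add: Mn_def z_def)
      ultimately have "x @ z \<in> X" by (auto simp: X_def)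
      moreover have "take N (x @ z) = x" using x by simp
      ultimately show "x \<in> take N ` X" by (metis imageI)
    qed
    show "take N ` X \<subseteq> ext N (\<lambda>s. P (\<lambda>i. s (f i)))"
    proof
      fix x assume "x \<in> take N ` X"
      then obtain u where u: "u \<in> X" "x = take N u" by blast
      then obtain z where z: "u = x @ z" "length x = N" "z \<in> ext n P"
        by (auto simp: X_def C_def)
      have "z ! i = x ! f i" if "i < n" for i
      proof -
        have "u \<in> E i" using u that by (auto simp: X_def)
        then show ?thesis using z N[OF that] by (simp add: E_def nth_append)
      qed
      then have "P (nth z) = P (\<lambda>i. x ! f i)" by (rule depD[OF n(1)])
      then show "x \<in> ext N (\<lambda>s. P (\<lambda>i. s (f i)))" using z by (simp add: ext_def Mn_def)
    qed
  qed
  moreover have "dep N (\<lambda>s. P (\<lambda>i. s (f i)))"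
    unfolding dep_def by (intro allI impI depD[OF n(1)]) (simp add: N)
  ultimately show ?thesis using S_take[OF X] by (auto simp: dfn_def)
qed

text \<open>The axioms project away the last coordinate, whereas the bound variable is variable 0.
  The renaming \<open>f\<close> moves it to position n, behind all variables that the body can still
  depend on.\<close>

lemma dfn_ex:
  assumes "dfn (\<lambda>s. P (s 0) (\<lambda>i. s (Suc i)))"
  shows "dfn (\<lambda>s. \<exists>y::'m. P y s)"
proof -
  define Q where "Q = (\<lambda>s. P (s 0) (\<lambda>i. s (Suc i)))"
  obtain n where n: "dep n Q" using assms unfolding dfn_def Q_def by blast
  \<comment> \<open>With this bound only the free variables below n matter besides the bound one,
    also when n = 0.\<close>
  have depQ: "dep (Suc n) Q" by (rule dep_mono[OF n]) simp
  define f where "f i = (case i of 0 \<Rightarrow> n | Suc j \<Rightarrow> j)" for i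
  define Q' where "Q' = (\<lambda>s. Q (\<lambda>i. s (f i)))"
  have dQ': "dfn Q'" unfolding Q'_def using assms unfolding Q_def[symmetric] by (rule dfn_rename)
  have "f i < Suc n" if "i < Suc n" for i using that by (auto simp: f_def split: nat.splits)
  then have "dep (Suc n) Q'" unfolding dep_def Q'_def
    by (intro allI impI depD[OF depQ]) simp
  from ext_S[OF dQ' this] have e: "ext (Suc n) Q' \<in> S (Suc n)" .
  have Q': "Q' s = P (s n) s" for s unfolding Q'_def Q_def by (simp add: f_def)
  have QP: "P y s = Q (case_nat y s)" for y s by (simp add: Q_def)
  have dP: "P y s = P y t" if "\<And>i. i < n \<Longrightarrow> s i = t i" for y s t
    unfolding QP by (rule depD[OF depQ]) (auto simp: that split: nat.splits)
  have "ext n (\<lambda>s. \<exists>y. P y s) = butlast ` ext (Suc n) Q'"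
  proof
    show "ext n (\<lambda>s. \<exists>y. P y s) \<subseteq> butlast ` ext (Suc n) Q'"
    proof
      fix x assume "x \<in> ext n (\<lambda>s. \<exists>y. P y s)"
      then obtain y where x: "length x = n" "P y (nth x)" by (auto simp: ext_def Mn_def)
      have "P y (nth x) = P y (nth (x @ [y]))" by (rule dP) (simp add: nth_append x)
      moreover have "(x @ [y]) ! n = y" by (simp flip: x(1))
      ultimately have "x @ [y] \<in> ext (Suc n) Q'" using x by (simp add: ext_def Mn_def Q' del: nth_append_length)
      then show "x \<in> butlast ` ext (Suc n) Q'" by (metis butlast_snoc imageI)
    qed
    show "butlast ` ext (Suc n) Q' \<subseteq> ext n (\<lambda>s. \<exists>y. P y s)"
    proof
      fix x assume "x \<in> butlast ` ext (Suc n) Q'"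
      then obtain z where z: "x = butlast z" "length z = Suc n" "P (z ! n) (nth z)"
        by (auto simp: ext_def Mn_def Q')
      have "P (z ! n) (nth z) = P (z ! n) (nth x)" by (rule dP) (simp add: z nth_butlast)
      then show "x \<in> ext n (\<lambda>s. \<exists>y. P y s)" using z by (auto simp: ext_def Mn_def)
    qed
  qed
  moreover have "dep n (\<lambda>s. \<exists>y. P y s)" unfolding dep_def using dP by metis
  ultimately show ?thesis using S_butlast[OF e] by (auto simp: dfn_def)
qed

lemma dfn_all:
  assumes "dfn (\<lambda>s. P (s 0) (\<lambda>i. s (Suc i)))"
  shows "dfn (\<lambda>s. \<forall>y::'m. P y s)"
  using dfn_not[OF dfn_ex[of "\<lambda>y s. \<not> P y s"]] dfn_not[OF assms] by simp

text \<open>A tuple is a block of d variables bound one by one. The head is variable 0 and is bound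
  innermost, so the body changes along the induction and P has to be arbitrary.\<close>

lemma dfn_ex_list:
  assumes "dfn (\<lambda>s. P (map s [0..<d]) (\<lambda>i. s (i + d)))"
  shows "dfn (\<lambda>s. \<exists>ys::'m list. length ys = d \<and> P ys s)"
  using assms
proof (induction d arbitrary: P)
  case 0
  then show ?case by simp
next
  case (Suc d)
  have eq: "map s [0..<Suc d] = s 0 # map (\<lambda>i. s (Suc i)) [0..<d]" for s :: "nat \<Rightarrow> 'm"
    by (simp only: map_upt_Suc)
  have "dfn (\<lambda>s. \<exists>ys. length ys = d \<and> (\<exists>y. P (y # ys) s))"
  proof (rule Suc.IH, rule dfn_ex)
    show "dfn (\<lambda>s. P (s 0 # map (\<lambda>i. s (Suc i)) [0..<d]) (\<lambda>i. s (Suc (i + d))))"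
      using Suc.prems unfolding eq by simp
  qed
  moreover have "(\<exists>ys. length ys = Suc d \<and> P ys s) = (\<exists>ys. length ys = d \<and> (\<exists>y. P (y # ys) s))" for s
    by (auto simp: length_Suc_conv)
  ultimately show ?case by simp
qed

lemma dfn_all_list:
  assumes "dfn (\<lambda>s. P (map s [0..<d]) (\<lambda>i. s (i + d)))"
  shows "dfn (\<lambda>s. \<forall>ys::'m list. length ys = d \<longrightarrow> P ys s)"
  using dfn_not[OF dfn_ex_list[of "\<lambda>y s. \<not> P y s"]] dfn_not[OF assms] by simp

section \<open>Definable terms and substitution of terms into formulas\<close>

text \<open>This is definability of the graph, with the value in variable 0 and the arguments
  shifted, which is the form that \<open>dfn_ex\<close> binds.\<close>

definition tm :: "((nat \<Rightarrow> 'm) \<Rightarrow> 'm) \<Rightarrow> bool" where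
  "tm t \<longleftrightarrow> dfn (\<lambda>s. s 0 = t (\<lambda>i. s (Suc i)))"

definition tv :: "nat \<Rightarrow> ((nat \<Rightarrow> 'm) \<Rightarrow> 'm list) \<Rightarrow> bool" where
  "tv d v \<longleftrightarrow> (\<forall>s. length (v s) = d) \<and> (\<forall>i<d. tm (\<lambda>s. v s ! i))"

text \<open>One-point rule: P holds at \<open>t s\<close> iff some y equal to \<open>t s\<close>
  satisfies it, and the graph of t is definable.\<close>

lemma dfn_subst:
  assumes "tm t" "dfn (\<lambda>s. P (s 0) (\<lambda>i. s (Suc i)))"
  shows "dfn (\<lambda>s. P (t s) s)"
proof -
  have "dfn (\<lambda>s. \<exists>y. y = t s \<and> P y s)"
    by (rule dfn_ex, rule dfn_conj) (use assms in \<open>simp_all add: tm_def\<close>)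
  then show ?thesis by simp
qed

lemma tm_rename:
  assumes "tm t"
  shows "tm (\<lambda>s. t (\<lambda>i. s (f i)))"
proof -
  have "dfn (\<lambda>s. (\<lambda>s. s 0 = t (\<lambda>i. s (Suc i))) (\<lambda>i. s (case i of 0 \<Rightarrow> 0 | Suc j \<Rightarrow> Suc (f j))))"
    using assms unfolding tm_def by (rule dfn_rename)
  then show ?thesis by (simp add: tm_def)
qed

lemma dfn_subst2:
  assumes t: "tm t" and u: "tm u" and "dfn (\<lambda>s. P (s 0) (s (Suc 0)))"
  shows "dfn (\<lambda>s. P (t s) (u s))"
proof -
  have "dfn (\<lambda>s. P (s 0) (u (\<lambda>i. s (Suc i))))"
  proof (rule dfn_subst[of "\<lambda>s. u (\<lambda>i. s (Suc i))"])
    show "tm (\<lambda>s. u (\<lambda>i. s (Suc i)))" by (rule tm_rename[OF u])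
    show "dfn (\<lambda>s. P (s (Suc 0)) (s 0))"
      using dfn_rename[OF assms(3), of "\<lambda>i. if i = 0 then 1 else 0"] by simp
  qed
  then show ?thesis by (rule dfn_subst[OF t])
qed

lemma dfn_mem_var:
  assumes "A \<in> S n"
  shows "dfn (\<lambda>s. map (\<lambda>i. s (f i)) [0..<n] \<in> A)"
proof -
  have "ext n (\<lambda>s. map s [0..<n] \<in> A) = A"
    using S_subset[OF assms] by (auto simp: ext_def Mn_def map_nth)
  moreover have "dep n (\<lambda>s. map s [0..<n] \<in> A)"
    unfolding dep_def by (intro allI impI arg_cong[where f = "\<lambda>x. x \<in> A"]) simp
  ultimately have "dfn (\<lambda>s. map s [0..<n] \<in> A)" using assms by (auto simp: dfn_def)
  from dfn_rename[OF this, of f] show ?thesis .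
qed

lemma tm_var: "tm (\<lambda>s. s i)"
proof -
  have "{xs \<in> Mn (i+2). xs ! 0 = xs ! Suc i} = ext (i+2) (\<lambda>s. s 0 = s (Suc i))"
    by (simp add: ext_def)
  moreover have "{xs \<in> Mn (i+2). xs ! 0 = xs ! Suc i} \<in> S (i+2)" by (intro S_diagonal) auto
  ultimately show ?thesis unfolding tm_def dfn_def by (intro exI[of _ "i+2"]) (auto simp: dep_def)
qed

text \<open>Parameters enter here, through the definability of every singleton in M.\<close>

lemma tm_const: "tm (\<lambda>s. c)"
proof -
  have "{[c]} \<in> S 1" using o_minimal by (simp add: o_minimal_expansion_def)
  from dfn_mem_var[OF this, of "\<lambda>i. 0"] show ?thesis by (simp add: tm_def)
qed

lemma dfn_less: "tm t \<Longrightarrow> tm u \<Longrightarrow> dfn (\<lambda>s. t s < u s)"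
proof (rule dfn_subst2[where P = "(<)"])
  have *: "{[x::'m, y] | x y. x < y} \<in> S 2" using o_minimal by (simp add: o_minimal_expansion_def)
  have "[0..<2::nat] = [0,1]" by (simp add: upt_conv_Cons)
  then show "dfn (\<lambda>s::nat \<Rightarrow> 'm. s 0 < s (Suc 0))" using dfn_mem_var[OF *, of "\<lambda>i. i"] by simp
qed

lemma dfn_eq: "tm t \<Longrightarrow> tm u \<Longrightarrow> dfn (\<lambda>s. t s = u s)"
  by (rule dfn_subst2[where P = "(=)"]) (use tm_var[of 0] in \<open>auto simp: tm_def\<close>)

lemma dfn_le: "tm t \<Longrightarrow> tm u \<Longrightarrow> dfn (\<lambda>s. t s \<le> u s)"
  using dfn_not[OF dfn_less[of u t]] by (simp add: not_less)

lemma tm_fun2: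
  assumes t: "tm t" and u: "tm u" and "dfn (\<lambda>s. s 2 = f (s 0) (s 1))"
  shows "tm (\<lambda>s. f (t s) (u s))"
proof -
  have "dfn (\<lambda>s. \<exists>x y. x = t (\<lambda>i. s (Suc i)) \<and> y = u (\<lambda>i. s (Suc i)) \<and> s 0 = f x y)"
  proof (rule dfn_ex, rule dfn_ex, rule dfn_conj[OF dfn_eq dfn_conj[OF dfn_eq]])
    show "dfn (\<lambda>s. s (Suc (Suc 0)) = f (s (Suc 0)) (s 0))"
      \<comment> \<open>The inner quantifier puts y at variable 0 and x at variable 1, so the two
        arguments of f have to be swapped.\<close>
      using dfn_rename[OF assms(3), of "\<lambda>i. if i = 0 then 1 else if i = 1 then 0 else i"]
      by (simp add: numeral_2_eq_2)
  qed (rule tm_var tm_rename[OF t] tm_rename[OF u])+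
  then show ?thesis by (simp add: tm_def)
qed

lemma upt3: "[0..<3::nat] = [0,1,2]" by (simp add: upt_conv_Cons numeral_3_eq_3)

lemma tm_add: "tm t \<Longrightarrow> tm u \<Longrightarrow> tm (\<lambda>s. t s + u s)"
proof (rule tm_fun2[where f = "(+)"])
  have *: "{[x::'m, y, x + y] | x y. True} \<in> S 3" using o_minimal by (simp add: o_minimal_expansion_def)
  show "dfn (\<lambda>s::nat \<Rightarrow> 'm. s 2 = s 0 + s 1)" using dfn_mem_var[OF *, of "\<lambda>i. i"] by (simp add: upt3)
qed

lemma tm_mult: "tm t \<Longrightarrow> tm u \<Longrightarrow> tm (\<lambda>s. t s * u s)"
proof (rule tm_fun2[where f = "(*)"])
  have *: "{[x::'m, y, x * y] | x y. True} \<in> S 3" using o_minimal by (simp add: o_minimal_expansion_def)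
  show "dfn (\<lambda>s::nat \<Rightarrow> 'm. s 2 = s 0 * s 1)" using dfn_mem_var[OF *, of "\<lambda>i. i"] by (simp add: upt3)
qed

lemma tm_uminus: "tm t \<Longrightarrow> tm (\<lambda>s. - t s)"
  using tm_mult[OF tm_const[of "-1"], of t] by simp

lemma tm_diff: "tm t \<Longrightarrow> tm u \<Longrightarrow> tm (\<lambda>s. t s - u s)"
  using tm_add[OF _ tm_uminus, of t u] by simp

lemma tm_nth: "tv d v \<Longrightarrow> i < d \<Longrightarrow> tm (\<lambda>s. v s ! i)"
  by (simp add: tv_def)

lemma tv_map: "tv d (\<lambda>s. map (\<lambda>i. s (f i)) [0..<d])"
  by (simp add: tv_def tm_var)

lemma tv_const: "length c = d \<Longrightarrow> tv d (\<lambda>s. c)"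
  by (simp add: tv_def tm_const)

lemma tv_append: "tv d v \<Longrightarrow> tv k w \<Longrightarrow> tv (d + k) (\<lambda>s. v s @ w s)"
proof -
  assume a: "tv d v" "tv k w"
  have "tm (\<lambda>s. (v s @ w s) ! i)" if "i < d + k" for i
    using a that by (cases "i < d") (auto simp: tv_def nth_append)
  then show ?thesis using a by (simp add: tv_def)
qed

lemma tv_Nil: "tv 0 (\<lambda>s. [])" by (simp add: tv_def)

lemma tv_Cons: "tm t \<Longrightarrow> tv d v \<Longrightarrow> tv (Suc d) (\<lambda>s. t s # v s)"
proof -
  assume a: "tm t" "tv d v"
  have "tm (\<lambda>s. (t s # v s) ! i)" if "i < Suc d" for i
    using a that by (cases i) (auto simp: tv_def)
  then show ?thesis using a by (simp add: tv_def)
qed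

text \<open>The tuple of terms is replaced by a block of fresh variables that equals it entry by
  entry. The arity equation is a separate premise, so that it can be discharged by
  arithmetic.\<close>

lemma dfn_mem:
  assumes "A \<in> S m" "tv d v" "m = d"
  shows "dfn (\<lambda>s. v s \<in> A)"
proof -
  have "dfn (\<lambda>s. \<exists>ys. length ys = d \<and> ((\<forall>i<d. ys ! i = v s ! i) \<and> ys \<in> A))"
  proof (intro dfn_ex_list dfn_conj dfn_all_less dfn_eq)
    fix i assume i: "i < d"
    show "tm (\<lambda>s. map s [0..<d] ! i)" using i by (simp add: tm_var)
    have "tm (\<lambda>s. v s ! i)" using assms i by (simp add: tv_def)
    then show "tm (\<lambda>s. v (\<lambda>i. s (i + d)) ! i)" by (rule tm_rename)
  next
    show "dfn (\<lambda>s. map s [0..<d] \<in> A)" using dfn_mem_var[of A d "\<lambda>i. i"] assms by simp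
  qed
  moreover have "(\<exists>ys. length ys = d \<and> ((\<forall>i<d. ys ! i = v s ! i) \<and> ys \<in> A)) = (v s \<in> A)" for s
    using assms(2) by (auto simp: tv_def) (metis nth_equalityI)
  ultimately show ?thesis by simp
qed

section \<open>From formulas back to definable sets\<close>

lemma S_I:
  assumes "dfn (\<lambda>s. P (map s [0..<m]))"
  shows "{xs. length xs = m \<and> P xs} \<in> S m"
proof -
  have "dep m (\<lambda>s. P (map s [0..<m]))"
    unfolding dep_def by (intro allI impI arg_cong[where f = P]) simp
  from ext_S[OF assms this] have "ext m (\<lambda>s. P (map s [0..<m])) \<in> S m" .
  moreover have "ext m (\<lambda>s. P (map s [0..<m])) = {xs. length xs = m \<and> P xs}"
    by (auto simp: ext_def Mn_def map_nth)
  ultimately show ?thesis by simp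
qed

lemma S_I_append:
  assumes "dfn (\<lambda>s. P (map s [0..<d]) (map (\<lambda>i. s (i + d)) [0..<m]))"
  shows "{x @ w | x w. length x = d \<and> length w = m \<and> P x w} \<in> S (d + m)"
proof -
  have "take d (map s [0..<d+m]) = map s [0..<d]"
       "drop d (map s [0..<d+m]) = map (\<lambda>i. s (i + d)) [0..<m]" for s :: "nat \<Rightarrow> 'm"
    by (simp add: take_map) (rule nth_equalityI, simp_all add: add.commute)
  then have "{xs. length xs = d + m \<and> P (take d xs) (drop d xs)} \<in> S (d + m)"
    using assms by (intro S_I) simp
  moreover have "{xs. length xs = d + m \<and> P (take d xs) (drop d xs)}
    = {x @ w | x w. length x = d \<and> length w = m \<and> P x w}" (is "?L = ?R")
  proof
    show "?L \<subseteq> ?R"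
      by (smt (verit) mem_Collect_eq subsetI append_take_drop_id length_drop length_take add_diff_cancel_left' min_absorb2 le_add1)
  qed auto
  ultimately show ?thesis by simp
qed

lemma S_I_snoc:
  assumes "dfn (\<lambda>s. P (map s [0..<d]) (s d))"
  shows "{x @ [t] | x t. length x = d \<and> P x t} \<in> S (Suc d)"
proof -
  have "{x @ w | x w. length x = d \<and> length w = 1 \<and> P x (w ! 0)} \<in> S (d + 1)"
    using assms by (intro S_I_append) simp
  moreover have "{x @ w | x w. length x = d \<and> length w = 1 \<and> P x (w ! 0)} = {x @ [t] | x t. length x = d \<and> P x t}"
    by (auto simp: length_Suc_conv) (metis length_Cons list.size(3) nth_Cons_0)
  ultimately show ?thesis by simp
qed

lemma snoc_mem: "x @ [t] \<in> {x @ [t] | x t. length x = d \<and> P x t} \<longleftrightarrow> length x = d \<and> P x t"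
  by auto

lemma append_mem: "length x = d \<Longrightarrow>
  x @ w \<in> {x @ w | x w. length x = d \<and> length w = m \<and> P x w} \<longleftrightarrow> length w = m \<and> P x w"
  by auto

lemma dfn_box:
  assumes "tv d a" "tv d b" "tv d x"
  shows "dfn (\<lambda>s. x s \<in> Mbox (a s) (b s))"
proof -
  have "dfn (\<lambda>s. \<forall>i<d. a s ! i < x s ! i \<and> x s ! i < b s ! i)"
    using assms by (intro dfn_all_less dfn_conj dfn_less) (auto intro: tm_nth)
  then show ?thesis using assms by (simp add: Mbox_def tv_def)
qed


text \<open>Together with \<open>dfn_mem\<close> for the given definable sets, these rules follow
  the syntax of a formula and reduce its definability to equations between lengths.\<close>

lemmas definable_intros =
  dfn_ex_list dfn_all_list dfn_ex dfn_all dfn_conj dfn_imp dfn_not dfn_less dfn_le dfn_eq dfn_box dfn_all_less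
  tm_var tm_const tm_add tm_mult tm_uminus tm_nth tm_diff tv_map tv_const tv_append tv_Cons tv_Nil

section \<open>One-dimensional definable sets and relations\<close>

text \<open>The shapes allowed by o-minimality. An interval with a \<ge> b is empty, so a piece may
  be empty.\<close>

definition piece :: "'m set \<Rightarrow> bool" where
  "piece I \<longleftrightarrow> (\<exists>a. I = {a}) \<or> (\<exists>a b. I = {a<..<b}) \<or> (\<exists>a. I = {a<..}) \<or> (\<exists>b. I = {..<b}) \<or> I = UNIV"

lemma dfn_pieces:
  assumes "dfn (\<lambda>s. P (s 0))"
  obtains F where "finite F" "Collect P = \<Union>F" "\<And>I. I \<in> F \<Longrightarrow> piece I"
proof -
  have A: "{x. length x = 1 \<and> P (x ! 0)} \<in> S 1" using assms by (intro S_I) simp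
  have hd: "hd ` {x. length x = 1 \<and> P (x ! 0)} = Collect P"
  proof
    show "Collect P \<subseteq> hd ` {x. length x = 1 \<and> P (x ! 0)}"
      by (intro subsetI image_eqI[of _ hd "[_]"]) simp_all
  qed (auto simp: length_Suc_conv)
  have "\<forall>A\<in>S 1. \<exists>F. finite F \<and> hd ` A = \<Union>F \<and> (\<forall>I\<in>F. piece I)"
    using o_minimal unfolding o_minimal_expansion_def piece_def by (elim conjE)
  from bspec[OF this A] show ?thesis unfolding hd using that by blast
qed

text \<open>One of the finitely many pieces is infinite. It is then neither a point nor an empty
  interval, and every other shape contains a nonempty open interval.\<close>

lemma infinite_dfn_interval:
  assumes "dfn (\<lambda>s. P (s 0))" "infinite {x. P x}"
  obtains c d where "c < d" "\<And>x. c < x \<Longrightarrow> x < d \<Longrightarrow> P x"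
proof -
  obtain F where F: "finite F" "Collect P = \<Union>F"
    "\<And>I. I \<in> F \<Longrightarrow> piece I"
    using dfn_pieces[OF assms(1)] by blast
  obtain I where I: "I \<in> F" "infinite I" using assms(2) finite_Union[OF F(1)] F(2) by auto
  have "\<exists>c d. c < d \<and> {c<..<d} \<subseteq> I"
  proof -
    consider a where "I = {a}" | a b where "I = {a<..<b}" | a where "I = {a<..}"
      | b where "I = {..<b}" | "I = UNIV" using F(3)[OF I(1)] unfolding piece_def by blast
    then show ?thesis
    proof cases
      case 1 then show ?thesis using I by simp
    next
      case (2 a b)
      then have "a < b" using I(2) by (cases "a < b") auto
      then show ?thesis using 2 by blast
    next
      case (3 a)
      then have "a < a + 1 \<and> {a<..<a+1} \<subseteq> I" by auto
      then show ?thesis by blast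
    next
      case (4 b)
      then have "b - 1 < b \<and> {b-1<..<b} \<subseteq> I" by auto
      then show ?thesis by blast
    next
      case 5
      then have "(0::'m) < 1 \<and> {0<..<1} \<subseteq> I" by auto
      then show ?thesis by blast
    qed
  qed
  moreover have "I \<subseteq> {x. P x}" using F(2) I(1) by blast
  ultimately show ?thesis using that by (metis greaterThanLessThan_iff mem_Collect_eq subsetD)
qed

text \<open>The smallest of the infima of the members works. Infima are expressed by approximation,
  since the order of M need not be complete.\<close>

lemma finite_union_inf:
  fixes F :: "'m set set"
  assumes "finite F" "\<And>I. I \<in> F \<Longrightarrow> I \<noteq> {} \<Longrightarrow> \<exists>m. (\<forall>x\<in>I. m \<le> x) \<and> (\<forall>e>0. \<exists>x\<in>I. x < m + e)" "\<Union>F \<noteq> {}"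
  shows "\<exists>m. (\<forall>x\<in>\<Union>F. m \<le> x) \<and> (\<forall>e>0. \<exists>x\<in>\<Union>F. x < m + e)"
  using assms
proof (induction F rule: finite_induct)
  case empty
  then show ?case by simp
next
  case (insert I F)
  show ?case
  proof (cases "I = {}")
    case True
    then show ?thesis using insert by simp
  next
    case False
    then obtain m where m: "\<forall>x\<in>I. m \<le> x" "\<forall>e>0. \<exists>x\<in>I. x < m + e" using insert.prems(1)[of I] by blast
    show ?thesis
    proof (cases "\<Union>F = {}")
      case True
      then show ?thesis using m by (intro exI[of _ m]) auto
    next
      case False
      then obtain n where n: "\<forall>x\<in>\<Union>F. n \<le> x" "\<forall>e>0. \<exists>x\<in>\<Union>F. x < n + e" using insert by auto
      show ?thesis
      proof (cases "m \<le> n")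
        case True
        then show ?thesis using m n by (intro exI[of _ m]) (auto intro: order_trans)
      next
        case False
        then have "\<forall>x\<in>I. n \<le> x" using m(1) by (meson le_cases order_trans)
        then have "\<forall>x\<in>\<Union>(insert I F). n \<le> x" using n(1) by auto
        moreover have "\<forall>e>0. \<exists>x\<in>\<Union>(insert I F). x < n + e" using n(2) by (metis Union_iff insert_iff)
        ultimately show ?thesis by blast
      qed
    qed
  qed
qed

text \<open>Definable completeness. Each nonempty piece that is bounded below has its left end as
  infimum, and nonnegativity excludes the pieces that are unbounded below.\<close>

lemma dfn_inf:
  assumes "dfn (\<lambda>s. P (s 0))" "P x" "\<And>x. P x \<Longrightarrow> 0 \<le> x"
  obtains m where "\<And>x. P x \<Longrightarrow> m \<le> x" "\<And>e. e > 0 \<Longrightarrow> \<exists>x. P x \<and> x < m + e"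
proof -
  obtain F where F: "finite F" "Collect P = \<Union>F"
    "\<And>I. I \<in> F \<Longrightarrow> piece I"
    using dfn_pieces[OF assms(1)] by blast
  have "\<exists>m. (\<forall>x\<in>\<Union>F. m \<le> x) \<and> (\<forall>e>0. \<exists>x\<in>\<Union>F. x < m + e)"
  proof (rule finite_union_inf[OF F(1)])
    show "\<Union>F \<noteq> {}" using assms(2) F(2) by blast
    fix I assume I: "I \<in> F" "I \<noteq> {}"
    have pos: "\<And>x. x \<in> I \<Longrightarrow> 0 \<le> x" using F(2) I(1) assms(3) by blast
    have right: "\<exists>x. a < x \<and> x < b \<and> x < a + e" if "a < b" "0 < e" for a b e :: 'm
      using dense[of a "min b (a + e)"] that by auto
    consider a where "I = {a}" | a b where "I = {a<..<b}" | a where "I = {a<..}"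
      | b where "I = {..<b}" | "I = UNIV" using F(3)[OF I(1)] unfolding piece_def by blast
    then show "\<exists>m. (\<forall>x\<in>I. m \<le> x) \<and> (\<forall>e>0. \<exists>x\<in>I. x < m + e)"
    proof cases
      case (1 a)
      then show ?thesis by (intro exI[of _ a]) auto
    next
      case (2 a b)
      then have "a < b" using I(2) by auto
      from right[OF this] show ?thesis unfolding 2 by (intro exI[of _ a]) (auto simp: Bex_def)
    next
      case (3 a)
      have "a < a + 1" by simp
      from right[OF this] show ?thesis unfolding 3 by (intro exI[of _ a]) (auto simp: Bex_def)
    next
      case (4 b)
      \<comment> \<open>A negative point of the piece, against \<open>pos\<close>.\<close>
      have "min (b - 1) (-1) \<in> I" unfolding 4 lessThan_iff by (simp add: min_less_iff_disj)
      from pos[OF this] have "0 \<le> min (b - 1) (-1)" .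
      then show ?thesis by simp
    next
      case 5
      then show ?thesis using pos[of "-1"] by simp
    qed
  qed
  then obtain m where "\<forall>x\<in>Collect P. m \<le> x" "\<forall>e>0. \<exists>x\<in>Collect P. x < m + e"
    unfolding F(2) by blast
  then show ?thesis using that[of m] by blast
qed

section \<open>Near-constant selection over an interval\<close>

text \<open>Fibres that meet the nonnegative half line have infima in M. It suffices that infinitely
  many of these infima share an interval of length \<epsilon>/2: the set of their base points then
  contains an interval, and each fibre has points arbitrarily close to its infimum.\<close>

lemma strip_near_const_pos:
  assumes R: "R \<in> S 2" and ab: "a < b" and e: "0 < (\<epsilon>::'m)"
    and ne: "\<And>x. a < x \<Longrightarrow> x < b \<Longrightarrow> \<exists>t\<ge>0. [x, t] \<in> R"
  obtains c d p where "c < d" "\<And>x. c < x \<Longrightarrow> x < d \<Longrightarrow> a < x \<and> x < b \<and> (\<exists>t. p \<le> t \<and> t \<le> p + \<epsilon> \<and> [x, t] \<in> R)"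
proof -
  note result = that
  \<comment> \<open>The graph of the infimum of the nonnegative part of the fibre; it also records
    that x lies in the base interval.\<close>
  define G where "G x m \<longleftrightarrow> a < x \<and> x < b \<and> (\<forall>t. 0 \<le> t \<and> [x, t] \<in> R \<longrightarrow> m \<le> t)
    \<and> (\<forall>e. 0 < e \<longrightarrow> (\<exists>t. 0 \<le> t \<and> [x, t] \<in> R \<and> t < m + e))" for x m
  have dG: "dfn (\<lambda>s. G (s i) (s j))" "dfn (\<lambda>s. G (s i) c)" for i j c unfolding G_def
    by (rule definable_intros dfn_mem[OF R] | simp)+
  have Gex: "\<exists>m. G x m" if x: "a < x" "x < b" for x
  proof -
    have "dfn (\<lambda>s. 0 \<le> s 0 \<and> [x, s 0] \<in> R)" by (rule definable_intros dfn_mem[OF R] | simp)+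
    moreover obtain t where "0 \<le> t \<and> [x, t] \<in> R" using ne[OF x] by blast
    ultimately obtain m where "\<And>t. 0 \<le> t \<and> [x, t] \<in> R \<Longrightarrow> m \<le> t"
       "\<And>e. e > 0 \<Longrightarrow> \<exists>t. (0 \<le> t \<and> [x, t] \<in> R) \<and> t < m + e"
      using dfn_inf[of "\<lambda>t. 0 \<le> t \<and> [x, t] \<in> R" t] by blast
    then have "G x m" using x unfolding G_def by blast
    then show ?thesis ..
  qed
  have le: "m \<le> m'" if "G x m" "G x m'" for x m m'
  proof (rule ccontr)
    assume "\<not> m \<le> m'"
    then have "0 < m - m'" by simp
    with that(2) obtain t where "0 \<le> t" "[x, t] \<in> R" "t < m' + (m - m')" unfolding G_def by blast
    then show False using that(1) unfolding G_def by auto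
  qed
  have Gun: "m = m'" if "G x m" "G x m'" for x m m' using le[of x m m'] le[of x m' m] that by simp
  have near: "\<exists>t. p \<le> t \<and> t \<le> p + \<epsilon> \<and> [x, t] \<in> R" if "G x m" "p \<le> m" "m \<le> p + \<epsilon>/2" for x m p
  proof -
    have "0 < \<epsilon>/2" using e by simp
    with that(1) obtain t where t: "0 \<le> t" "[x, t] \<in> R" "t < m + \<epsilon>/2" unfolding G_def by blast
    then have "m \<le> t" using that(1) unfolding G_def by blast
    moreover have "t \<le> p + \<epsilon>/2 + \<epsilon>/2" using t(3) that(3) by linarith
    ultimately show ?thesis using t that(2) by (intro exI[of _ t]) (simp add: add.assoc)
  qed
  \<comment> \<open>One half of \<epsilon> pays for the spread of the infima, the other for the
    distance from an infimum to a point of its fibre.\<close>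
  have main: ?thesis if inf: "infinite {x. \<exists>m. p \<le> m \<and> m \<le> p + \<epsilon>/2 \<and> G x m}" for p
  proof -
    have "dfn (\<lambda>s. \<exists>m. p \<le> m \<and> m \<le> p + \<epsilon>/2 \<and> G (s 0) m)"
      by (rule definable_intros dG | simp)+
    then obtain c d where "c < d" "\<And>x. c < x \<Longrightarrow> x < d \<Longrightarrow> \<exists>m. p \<le> m \<and> m \<le> p + \<epsilon>/2 \<and> G x m"
      by (rule infinite_dfn_interval[OF _ inf]) blast
    then show ?thesis using result[of c d p] near[of _ _ p] unfolding G_def by blast
  qed
  show ?thesis
  proof (cases "\<exists>c. infinite {x. G x c}")
    case True
    then obtain c where "infinite {x. G x c}" by blast
    moreover have "{x. G x c} \<subseteq> {x. \<exists>m. c \<le> m \<and> m \<le> c + \<epsilon>/2 \<and> G x m}" using e by auto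
    ultimately show ?thesis using main finite_subset by blast
  next
    case False
    \<comment> \<open>All level sets are finite in this case, so finitely many values could not
      account for an infinite interval of base points.\<close>
    have "infinite {m. \<exists>x. G x m}"
    proof
      assume "finite {m. \<exists>x. G x m}"
      then have "finite (\<Union>m\<in>{m. \<exists>x. G x m}. {x. G x m})" using False by blast
      moreover have "{a<..<b} \<subseteq> (\<Union>m\<in>{m. \<exists>x. G x m}. {x. G x m})" using Gex by fastforce
      ultimately have "finite {a<..<b}" using finite_subset by blast
      then show False using infinite_Ioo[OF ab] by contradiction
    qed
    moreover have "dfn (\<lambda>s. \<exists>x. G x (s 0))" by (rule definable_intros dG | simp)+
    ultimately obtain c d where cd: "c < d" "\<And>m. c < m \<Longrightarrow> m < d \<Longrightarrow> \<exists>x. G x m"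
      using infinite_dfn_interval[of "\<lambda>m. \<exists>x. G x m"] by blast
    \<comment> \<open>The interval of attained values is cut to length at most \<epsilon>/2, as
      \<open>main\<close> requires.\<close>
    define d' where "d' = min d (c + \<epsilon>/2)"
    have d': "c < d'" "d' \<le> d" "d' \<le> c + \<epsilon>/2" using cd e by (auto simp: d'_def)
    let ?X = "{x. \<exists>m. c \<le> m \<and> m \<le> c + \<epsilon>/2 \<and> G x m}"
    have "infinite ?X"
    proof
      assume "finite ?X"
      \<comment> \<open>The infimum is a function of x, so a finite \<open>?X\<close> would attain
        only finitely many values.\<close>
      moreover have "{c<..<d'} \<subseteq> (\<lambda>x. THE m. G x m) ` ?X"
      proof
        fix m assume m: "m \<in> {c<..<d'}"
        then obtain x where x: "G x m" using cd(2)[of m] d' by auto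
        then have the: "m = (THE m. G x m)" using Gun by (metis the_equality)
        have "c \<le> m \<and> m \<le> c + \<epsilon>/2 \<and> G x m" using m d' x by auto
        then have "x \<in> ?X" unfolding mem_Collect_eq by (rule exI[of _ m])
        with the show "m \<in> (\<lambda>x. THE m. G x m) ` ?X" by (intro image_eqI[of _ _ x]) simp_all
      qed
      ultimately have "finite {c<..<d'}" using finite_surj by blast
      then show False using infinite_Ioo[OF d'(1)] by contradiction
    qed
    then show ?thesis by (rule main)
  qed
qed

text \<open>Infinitely many fibres meet the nonnegative half line, or infinitely many meet the
  nonpositive one. The second case becomes the first under t \<mapsto> - t.\<close>

lemma strip_near_const:
  assumes R: "R \<in> S 2" and ab: "a < b" and e: "0 < (\<epsilon>::'m)"
    and ne: "\<And>x. a < x \<Longrightarrow> x < b \<Longrightarrow> \<exists>t. [x, t] \<in> R"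
  obtains c d p where "c < d" "\<And>x. c < x \<Longrightarrow> x < d \<Longrightarrow> a < x \<and> x < b \<and> (\<exists>t. p \<le> t \<and> t \<le> p + \<epsilon> \<and> [x, t] \<in> R)"
proof -
  let ?A = "{x. a < x \<and> x < b \<and> (\<exists>t. 0 \<le> t \<and> [x, t] \<in> R)}"
  let ?B = "{x. a < x \<and> x < b \<and> (\<exists>t. 0 \<le> t \<and> [x, - t] \<in> R)}"
  have "{a<..<b} \<subseteq> ?A \<union> ?B"
  proof
    fix x assume "x \<in> {a<..<b}"
    then obtain t where x: "a < x" "x < b" and t: "[x, t] \<in> R" using ne by auto
    have "0 \<le> t \<and> [x, t] \<in> R \<or> 0 \<le> - t \<and> [x, - (- t)] \<in> R" using t by auto
    then show "x \<in> ?A \<union> ?B" using x by blast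
  qed
  then have "infinite (?A \<union> ?B)" using infinite_super[OF _ infinite_Ioo[OF ab]] by blast
  then consider "infinite ?A" | "infinite ?B" by blast
  then show ?thesis
  proof cases
    case 1
    have "dfn (\<lambda>s. a < s 0 \<and> s 0 < b \<and> (\<exists>t. 0 \<le> t \<and> [s 0, t] \<in> R))"
      by (rule definable_intros dfn_mem[OF R] | simp)+
    from infinite_dfn_interval[OF this 1]
    obtain c d where cd: "c < d" "\<And>x. c < x \<Longrightarrow> x < d \<Longrightarrow> a < x \<and> x < b \<and> (\<exists>t. 0 \<le> t \<and> [x, t] \<in> R)" by blast
    show ?thesis
      by (rule strip_near_const_pos[OF R cd(1) e]) (use cd(2) that in \<open>blast+\<close>)
  next
    case 2
    have "dfn (\<lambda>s. a < s 0 \<and> s 0 < b \<and> (\<exists>t. 0 \<le> t \<and> [s 0, - t] \<in> R))"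
      by (rule definable_intros dfn_mem[OF R] | simp)+
    from infinite_dfn_interval[OF this 2]
    obtain c d where cd: "c < d" "\<And>x. c < x \<Longrightarrow> x < d \<Longrightarrow> a < x \<and> x < b \<and> (\<exists>t. 0 \<le> t \<and> [x, - t] \<in> R)" by blast
    let ?R = "{x. length x = 2 \<and> [x ! 0, - (x ! 1)] \<in> R}"
    have R': "?R \<in> S 2"
      by (rule S_I) (rule definable_intros dfn_mem[OF R] | simp)+
    have "\<exists>t\<ge>0. [x, t] \<in> ?R" if "c < x" "x < d" for x using cd(2)[OF that] by simp
    from strip_near_const_pos[OF R' cd(1) e this]
    obtain c' d' p where p0: "c' < d'" "\<And>x. c' < x \<Longrightarrow> x < d' \<Longrightarrow>
        c < x \<and> x < d \<and> (\<exists>t. p \<le> t \<and> t \<le> p + \<epsilon> \<and> [x, t] \<in> ?R)" by blast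
    have p: "c < x \<and> x < d \<and> (\<exists>t. p \<le> t \<and> t \<le> p + \<epsilon> \<and> [x, - t] \<in> R)" if "c' < x" "x < d'" for x
      using p0(2)[OF that] by simp
    \<comment> \<open>Reflection turns the interval from p to p + \<epsilon> into the one from - p -
      \<epsilon> to - p, so the new left end is - p - \<epsilon>.\<close>
    have "\<exists>t. - p - \<epsilon> \<le> t \<and> t \<le> - p - \<epsilon> + \<epsilon> \<and> [x, t] \<in> R" if x: "c' < x" "x < d'" for x
    proof -
      obtain t where "p \<le> t" "t \<le> p + \<epsilon>" "[x, - t] \<in> R" using p[OF x] by blast
      then show ?thesis by (intro exI[of _ "- t"]) (auto simp: algebra_simps)
    qed
    then show ?thesis using that[of c' d' "- p - \<epsilon>"] p0(1) p cd(2) by blast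
  qed
qed

section \<open>Boxes and near-constant selections\<close>

text \<open>\<open>list_all2\<close> also gives b the length d. For d = 0 the box is the single
  point \<open>[]\<close>.\<close>

definition nonempty_box :: "nat \<Rightarrow> 'm list \<Rightarrow> 'm list \<Rightarrow> bool" where
  "nonempty_box d a b \<longleftrightarrow> length a = d \<and> list_all2 (<) a b"

definition subbox :: "nat \<Rightarrow> 'm list \<Rightarrow> 'm list \<Rightarrow> 'm list \<Rightarrow> 'm list \<Rightarrow> bool" where
  "subbox d a' b' a b \<longleftrightarrow> nonempty_box d a' b' \<and> Mbox a' b' \<subseteq> Mbox a b"

lemma nonempty_box_length: "nonempty_box d a b \<Longrightarrow> length a = d \<and> length b = d"
  by (auto simp: nonempty_box_def dest: list_all2_lengthD)

lemma Mbox_length: "x \<in> Mbox a b \<Longrightarrow> length x = length a"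
  by (simp add: Mbox_def)

lemma subbox_trans: "subbox d a'' b'' a' b' \<Longrightarrow> subbox d a' b' a b \<Longrightarrow> subbox d a'' b'' a b"
  by (auto simp: subbox_def)

lemma subbox_refl: "nonempty_box d a b \<Longrightarrow> subbox d a b a b"
  by (simp add: subbox_def)

lemma subbox_nonempty: "subbox d a' b' a b \<Longrightarrow> nonempty_box d a' b'"
  by (simp add: subbox_def)

lemma Mbox_nonempty:
  assumes "nonempty_box d a b"
  obtains x where "x \<in> Mbox a b"
proof -
  have ab: "a ! i < b ! i" if "i < d" for i
    using assms that by (auto simp: nonempty_box_def list_all2_conv_all_nth)
  define x where "x = map (\<lambda>i. (a ! i + b ! i) / 2) [0..<d]"
  have "x \<in> Mbox a b" using ab nonempty_box_length[OF assms] by (simp add: Mbox_def x_def field_simps)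
  then show ?thesis using that by blast
qed

lemma Mbox_snoc:
  assumes "length a = length b"
  shows "x \<in> Mbox (a @ [p]) (b @ [q]) \<longleftrightarrow> (\<exists>y t. x = y @ [t] \<and> y \<in> Mbox a b \<and> p < t \<and> t < q)" (is "?L \<longleftrightarrow> ?R")
proof
  assume L: ?L
  then obtain y t where x: "x = y @ [t]" "length y = length a"
    by (auto simp: Mbox_def length_Suc_conv_rev)
  have *: "(a @ [p]) ! i < x ! i \<and> x ! i < (b @ [q]) ! i" if "i < Suc (length a)" for i
    using L that by (simp add: Mbox_def)
  have "y \<in> Mbox a b" unfolding Mbox_def
    using x *[OF less_SucI] assms by (simp add: nth_append)
  moreover have "p < t \<and> t < q" using *[of "length a"] x assms by (simp add: nth_append)
  ultimately show ?R using x by blast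
next
  assume ?R
  then obtain y t where x: "x = y @ [t]" "y \<in> Mbox a b" "p < t \<and> t < q" by blast
  then show ?L using assms by (auto simp: Mbox_def nth_append less_Suc_eq)
qed

lemma nonempty_box_snoc:
  "nonempty_box (Suc d) a b \<longleftrightarrow>
    (\<exists>a' b' p q. a = a' @ [p] \<and> b = b' @ [q] \<and> nonempty_box d a' b' \<and> p < q)" (is "?L \<longleftrightarrow> ?R")
proof
  assume L: ?L
  then have "length a = Suc d" "length b = Suc d" using nonempty_box_length by auto
  then obtain a' b' p q where "a = a' @ [p]" "b = b' @ [q]" "length a' = d" "length b' = d"
    by (auto simp: length_Suc_conv_rev)
  then show ?R using L by (auto simp: nonempty_box_def list_all2_append)
next
  assume ?R
  then show ?L by (auto simp: nonempty_box_def list_all2_append list_all2_lengthD)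
qed

section \<open>Near-constant selection over boxes, by induction on the dimension\<close>

text \<open>Stated for all relations at once, because the step to \<open>Suc d\<close> applies it to
  several auxiliary relations over d-dimensional boxes.\<close>

definition near_const :: "nat \<Rightarrow> bool" where
  "near_const d \<longleftrightarrow> (\<forall>R a b \<epsilon>. R \<in> S (Suc d) \<longrightarrow> nonempty_box d a b \<longrightarrow> 0 < \<epsilon> \<longrightarrow>
     (\<forall>x\<in>Mbox a b. \<exists>t. x @ [t] \<in> R) \<longrightarrow>
     (\<exists>a' b' p. subbox d a' b' a b \<and> (\<forall>x\<in>Mbox a' b'. \<exists>t. p \<le> t \<and> t \<le> p + \<epsilon> \<and> x @ [t] \<in> R)))"

lemma near_constD:
  assumes "near_const d" "R \<in> S (Suc d)" "nonempty_box d a b" "0 < \<epsilon>"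
    "\<And>x. x \<in> Mbox a b \<Longrightarrow> \<exists>t. x @ [t] \<in> R"
  obtains a' b' p where "subbox d a' b' a b" "\<forall>x\<in>Mbox a' b'. \<exists>t. p \<le> t \<and> t \<le> p + \<epsilon> \<and> x @ [t] \<in> R"
proof -
  have "\<forall>x\<in>Mbox a b. \<exists>t. x @ [t] \<in> R" using assms(5) by blast
  then have "\<exists>a' b' p. subbox d a' b' a b \<and> (\<forall>x\<in>Mbox a' b'. \<exists>t. p \<le> t \<and> t \<le> p + \<epsilon> \<and> x @ [t] \<in> R)"
    using assms(1-4) unfolding near_const_def by simp
  then show ?thesis using that by blast
qed

lemma near_const_0: "near_const 0"
  unfolding near_const_def
proof (intro allI impI)
  fix R a b and \<epsilon> :: 'm
  assume *: "nonempty_box 0 a b" "0 < \<epsilon>" "\<forall>x\<in>Mbox a b. \<exists>t. x @ [t] \<in> R"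
  have B: "Mbox a b = {[]}" using *(1) by (auto simp: nonempty_box_def Mbox_def)
  then obtain t where "[] @ [t] \<in> R" using *(3) by auto
  then have "\<forall>x\<in>Mbox a b. \<exists>u. t \<le> u \<and> u \<le> t + \<epsilon> \<and> x @ [u] \<in> R"
    unfolding B using *(2) by (intro ballI exI[of _ t]) simp
  then show "\<exists>a' b' p. subbox 0 a' b' a b \<and> (\<forall>x\<in>Mbox a' b'. \<exists>t. p \<le> t \<and> t \<le> p + \<epsilon> \<and> x @ [t] \<in> R)"
    using subbox_refl[OF *(1)] by blast
qed

text \<open>Apply near-constancy to the reciprocals \<open>1/t\<close>, which become bounded on a smaller box.\<close>

lemma uniform_lower_bound:
  assumes near: "near_const d" and R: "R \<in> S (Suc d)" and ab: "nonempty_box d a b"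
    and ne: "\<And>x. x \<in> Mbox a b \<Longrightarrow> \<exists>t>0. x @ [t] \<in> R"
    and down: "\<And>x t t'. x \<in> Mbox a b \<Longrightarrow> x @ [t] \<in> R \<Longrightarrow> 0 < t' \<Longrightarrow> t' < t \<Longrightarrow> x @ [t'] \<in> R"
  obtains a' b' t where "subbox d a' b' a b" "0 < t" "\<forall>x\<in>Mbox a' b'. x @ [t] \<in> R"
proof -
  \<comment> \<open>The reciprocal is written as the polynomial condition t * u = 1, which the rules
    for terms handle.\<close>
  let ?R = "{x @ [u] | x u. length x = d \<and> (0 < u \<and> (\<exists>t. t * u = 1 \<and> x @ [t] \<in> R))}"
  have R': "?R \<in> S (Suc d)"
    by (rule S_I_snoc) (rule definable_intros dfn_mem[OF R] | simp)+
  have fib: "\<exists>u. x @ [u] \<in> ?R" if x: "x \<in> Mbox a b" for x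
  proof -
    obtain t where "0 < t" "x @ [t] \<in> R" using ne[OF x] by blast
    then show ?thesis using Mbox_length[OF x] nonempty_box_length[OF ab]
      by (intro exI[of _ "1/t"]) (auto intro!: exI[of _ t])
  qed
  obtain a' b' p where sub: "subbox d a' b' a b"
    and p: "\<forall>x\<in>Mbox a' b'. \<exists>u. p \<le> u \<and> u \<le> p + 1 \<and> x @ [u] \<in> ?R"
    by (rule near_constD[OF near R' ab zero_less_one fib]) (assumption | rule that)+
  note p = p[rule_format]
  have bound: "\<exists>u t. 0 < u \<and> u \<le> p + 1 \<and> t * u = 1 \<and> x @ [t] \<in> R" if "x \<in> Mbox a' b'" for x
    using p[OF that] by auto
  have pos: "0 < p + 1"
    using Mbox_nonempty[OF subbox_nonempty[OF sub]] bound by (meson less_le_trans)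
  show ?thesis
  \<comment> \<open>Every selected u is at most p + 1, so its reciprocal lies strictly above 1 / (p
    + 2), as the strict inequality in \<open>down\<close> demands.\<close>
  proof (rule that[OF sub, of "1 / (p + 2)"])
    show "0 < 1 / (p + 2)" using pos by simp
    show "\<forall>x\<in>Mbox a' b'. x @ [1 / (p + 2)] \<in> R"
    proof
      fix x assume x: "x \<in> Mbox a' b'"
      then obtain u t where u: "0 < u" "u \<le> p + 1" "t * u = 1" "x @ [t] \<in> R" using bound by blast
      have t: "t = 1 / u" using u by (simp add: field_simps)
      have "1 / (p + 2) < t" unfolding t using u(1,2) by (intro divide_strict_left_mono) auto
      moreover have "x \<in> Mbox a b" using x sub by (auto simp: subbox_def)
      ultimately show "x @ [1 / (p + 2)] \<in> R" using down[OF _ u(4)] pos by simp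
    qed
  qed
qed

text \<open>First the lengths of the intervals are bounded below by a constant t, then their left
  ends are made constant up to t/2. Intervals of length t with such left ends have an interval of
  length t/2 in common.\<close>

lemma fibres_intervals_box:
  assumes near: "near_const d" and R: "R \<in> S (Suc d)" and ab: "nonempty_box d a b"
    and ne: "\<And>x. x \<in> Mbox a b \<Longrightarrow> \<exists>p q. p < q \<and> (\<forall>y. p < y \<and> y < q \<longrightarrow> x @ [y] \<in> R)"
  obtains a' b' p q where "subbox d a' b' a b" "p < q"
    "\<forall>x\<in>Mbox a' b'. \<forall>y. p < y \<longrightarrow> y < q \<longrightarrow> x @ [y] \<in> R"
proof -
  \<comment> \<open>The admissible lengths over x. Shrinking an interval keeps it inside the fibre,
    which is the downward closure needed for the lower bound.\<close>
  let ?R = "{x @ [t] | x t. length x = d \<and> (\<exists>p. \<forall>y. p < y \<and> y < p + t \<longrightarrow> x @ [y] \<in> R)}"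
  have R': "?R \<in> S (Suc d)"
    by (rule S_I_snoc) (rule definable_intros dfn_mem[OF R] | simp)+
  have neR: "\<exists>t>0. x @ [t] \<in> ?R" if x: "x \<in> Mbox a b" for x
  proof -
    obtain p q where "p < q" "\<forall>y. p < y \<and> y < q \<longrightarrow> x @ [y] \<in> R" using ne[OF x] by blast
    then have "0 < q - p \<and> (\<exists>p'. \<forall>y. p' < y \<and> y < p' + (q - p) \<longrightarrow> x @ [y] \<in> R)" by (auto intro!: exI[of _ p])
    then show ?thesis unfolding snoc_mem using Mbox_length[OF x] nonempty_box_length[OF ab]
      by (intro exI[of _ "q - p"]) simp
  qed
  have downR: "x @ [t'] \<in> ?R" if "x \<in> Mbox a b" "x @ [t] \<in> ?R" "0 < t'" "t' < t" for x t t'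
  proof -
    from that(2) obtain p where p: "length x = d" "\<forall>y. p < y \<and> y < p + t \<longrightarrow> x @ [y] \<in> R"
      unfolding snoc_mem by blast
    have "p + t' < p + t" using that(4) by simp
    then have "\<forall>y. p < y \<and> y < p + t' \<longrightarrow> x @ [y] \<in> R" using p(2) less_trans by blast
    then show ?thesis unfolding snoc_mem using p(1) by blast
  qed
  obtain a1 b1 t where sub1: "subbox d a1 b1 a b" "0 < t" and t: "\<forall>x\<in>Mbox a1 b1. x @ [t] \<in> ?R"
    by (rule uniform_lower_bound[OF near R' ab neR downR]) (assumption | rule that)+
  note t = t[rule_format]
  let ?R2 = "{x @ [p] | x p. length x = d \<and> (\<forall>y. p < y \<and> y < p + t \<longrightarrow> x @ [y] \<in> R)}"
  have R2: "?R2 \<in> S (Suc d)"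
    by (rule S_I_snoc) (rule definable_intros dfn_mem[OF R] | simp)+
  have t2: "0 < t/2" using sub1 by simp
  have fib: "\<exists>p. x @ [p] \<in> ?R2" if x: "x \<in> Mbox a1 b1" for x
    using t[OF x] unfolding snoc_mem by blast
  obtain a2 b2 p where sub2: "subbox d a2 b2 a1 b1"
    and p: "\<forall>x\<in>Mbox a2 b2. \<exists>u. p \<le> u \<and> u \<le> p + t/2 \<and> x @ [u] \<in> ?R2"
    by (rule near_constD[OF near R2 subbox_nonempty[OF sub1(1)] t2 fib]) (assumption | rule that)+
  note p = p[rule_format]
  show ?thesis
  \<comment> \<open>Each left end u satisfies p \<le> u \<le> p + t/2, so p + t/2 < y < p + t
    implies u < y < u + t.\<close>
  proof (rule that[OF subbox_trans[OF sub2 sub1(1)], of "p + t/2" "p + t"])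
    show "p + t/2 < p + t" using sub1 by simp
    show "\<forall>x\<in>Mbox a2 b2. \<forall>y. p + t/2 < y \<longrightarrow> y < p + t \<longrightarrow> x @ [y] \<in> R"
    proof (intro ballI allI impI)
      fix x y assume x: "x \<in> Mbox a2 b2" and y: "p + t/2 < y" "y < p + t"
      obtain u where u: "p \<le> u" "u \<le> p + t/2" "\<forall>y. u < y \<and> y < u + t \<longrightarrow> x @ [y] \<in> R"
        using p[OF x] unfolding snoc_mem by blast
      have "u < y" "y < u + t" using u(1,2) y by auto
      then show "x @ [y] \<in> R" using u(3) by blast
    qed
  qed
qed

text \<open>Split off the last coordinate y. Over each x the one-dimensional case gives an interval
  of y and a level r with tolerance \<epsilon>/2. Making r constant up to \<epsilon>/2 costs the
  other half of \<epsilon>; then \<open>fibres_intervals_box\<close> makes the interval of y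
  independent of x.\<close>

lemma near_const_Suc:
  assumes near: "near_const d"
  shows "near_const (Suc d)"
  unfolding near_const_def
proof (intro allI impI)
  fix R A B and \<epsilon> :: 'm
  assume R: "R \<in> S (Suc (Suc d))" and AB: "nonempty_box (Suc d) A B" and e: "0 < \<epsilon>"
    and ne: "\<forall>x\<in>Mbox A B. \<exists>t. x @ [t] \<in> R"
  obtain a b p q where A: "A = a @ [p]" "B = b @ [q]" and ab: "nonempty_box d a b" and pq: "p < q"
    using AB by (auto simp: nonempty_box_snoc)
  note len = nonempty_box_length[OF ab]
  have e2: "0 < \<epsilon>/2" using e by simp
  let ?R1 = "{x @ [r] | x r. length x = d \<and> (\<exists>c c'. c < c' \<and> (\<forall>y. c < y \<and> y < c' \<longrightarrow>
    p < y \<and> y < q \<and> (\<exists>t. r \<le> t \<and> t \<le> r + \<epsilon>/2 \<and> x @ [y, t] \<in> R)))}"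
  have R1: "?R1 \<in> S (Suc d)"
    by (rule S_I_snoc) (rule definable_intros dfn_mem[OF R] | simp)+
  have fib: "\<exists>r. x @ [r] \<in> ?R1" if x: "x \<in> Mbox a b" for x
  proof -
    have lx: "length x = d" using Mbox_length[OF x] len by simp
    have F: "{w. length w = 2 \<and> x @ w \<in> R} \<in> S 2"
      by (rule S_I) (rule definable_intros dfn_mem[OF R] | simp add: lx)+
    have fib: "\<exists>t. [y, t] \<in> {w. length w = 2 \<and> x @ w \<in> R}" if "p < y" "y < q" for y
    proof -
      have "x @ [y] \<in> Mbox A B" using that x len by (simp add: A Mbox_snoc)
      then show ?thesis using ne by fastforce
    qed
    obtain c c' r where "c < c'" "\<And>y. c < y \<Longrightarrow> y < c' \<Longrightarrow>
        p < y \<and> y < q \<and> (\<exists>t. r \<le> t \<and> t \<le> r + \<epsilon>/2 \<and> [y, t] \<in> {w. length w = 2 \<and> x @ w \<in> R})"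
      using strip_near_const[OF F pq e2 fib] by blast
    then show ?thesis unfolding snoc_mem using lx by blast
  qed
  obtain a1 b1 r where sub1: "subbox d a1 b1 a b"
    and r: "\<forall>x\<in>Mbox a1 b1. \<exists>t. r \<le> t \<and> t \<le> r + \<epsilon>/2 \<and> x @ [t] \<in> ?R1"
    by (rule near_constD[OF near R1 ab e2 fib]) (assumption | rule that)+
  note r = r[rule_format]
  \<comment> \<open>The bounds p < y < q are kept so that the last side of the new box stays inside
    the old one.\<close>
  let ?R2 = "{x @ [y] | x y. length x = d \<and> (p < y \<and> y < q \<and> (\<exists>t. r \<le> t \<and> t \<le> r + \<epsilon> \<and> x @ [y, t] \<in> R))}"
  have R2: "?R2 \<in> S (Suc d)"
    by (rule S_I_snoc) (rule definable_intros dfn_mem[OF R] | simp)+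
  have fib: "\<exists>c c'. c < c' \<and> (\<forall>y. c < y \<and> y < c' \<longrightarrow> x @ [y] \<in> ?R2)" if x: "x \<in> Mbox a1 b1" for x
  proof -
    have lx: "length x = d" using Mbox_length[OF x] nonempty_box_length[OF subbox_nonempty[OF sub1]] by simp
    obtain s c c' where s: "r \<le> s" "s \<le> r + \<epsilon>/2" "c < c'" and
      y: "\<And>y. c < y \<Longrightarrow> y < c' \<Longrightarrow> p < y \<and> y < q \<and> (\<exists>t. s \<le> t \<and> t \<le> s + \<epsilon>/2 \<and> x @ [y, t] \<in> R)"
      using r[OF x] unfolding snoc_mem by blast
    have "x @ [y] \<in> ?R2" if "c < y" "y < c'" for y
    proof -
      from y[OF that] obtain t where t: "s \<le> t" "t \<le> s + \<epsilon>/2" "x @ [y, t] \<in> R" by blast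
      have "r \<le> t" "t \<le> r + \<epsilon>" using s t by auto
      then show ?thesis unfolding snoc_mem using lx y[OF that] t by blast
    qed
    then show ?thesis using s(3) by blast
  qed
  obtain a2 b2 c c' where sub2: "subbox d a2 b2 a1 b1" and c: "c < c'"
    "\<forall>x\<in>Mbox a2 b2. \<forall>y. c < y \<longrightarrow> y < c' \<longrightarrow> x @ [y] \<in> ?R2"
    by (rule fibres_intervals_box[OF near R2 subbox_nonempty[OF sub1] fib]) (assumption | rule that)+
  note c = c[rule_format]
  note sub = subbox_trans[OF sub2 sub1]
  note len2 = nonempty_box_length[OF subbox_nonempty[OF sub]]
  have "subbox (Suc d) (a2 @ [c]) (b2 @ [c']) A B"
    unfolding subbox_def
  proof
    show "nonempty_box (Suc d) (a2 @ [c]) (b2 @ [c'])"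
      using subbox_nonempty[OF sub2] c(1) by (simp add: nonempty_box_snoc)
    show "Mbox (a2 @ [c]) (b2 @ [c']) \<subseteq> Mbox A B"
    proof
      fix z assume "z \<in> Mbox (a2 @ [c]) (b2 @ [c'])"
      then obtain x y where z: "z = x @ [y]" "x \<in> Mbox a2 b2" "c < y" "y < c'"
        using len2 by (auto simp: Mbox_snoc)
      then have "p < y" "y < q" using c(2)[OF z(2-4)] unfolding snoc_mem by auto
      moreover have "x \<in> Mbox a b" using sub z(2) by (auto simp: subbox_def)
      ultimately show "z \<in> Mbox A B" using len by (simp add: A Mbox_snoc z(1))
    qed
  qed
  moreover have "\<exists>t. r \<le> t \<and> t \<le> r + \<epsilon> \<and> z @ [t] \<in> R" if "z \<in> Mbox (a2 @ [c]) (b2 @ [c'])" for z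
  proof -
    from that obtain x y where z: "z = x @ [y]" "x \<in> Mbox a2 b2" "c < y" "y < c'"
      using len2 by (auto simp: Mbox_snoc)
    then show ?thesis using c(2)[OF z(2-4)] unfolding snoc_mem by simp
  qed
  ultimately show "\<exists>a' b' p. subbox (Suc d) a' b' A B \<and>
      (\<forall>x\<in>Mbox a' b'. \<exists>t. p \<le> t \<and> t \<le> p + \<epsilon> \<and> x @ [t] \<in> R)" by blast
qed

lemma near_const: "near_const d"
  by (induction d) (simp_all add: near_const_0 near_const_Suc)

section \<open>Finite covers, tuples of values, and a point of local openness\<close>

text \<open>Relate each point to the indices of the members that contain it, read as elements of M.
  An interval of length 1/2 contains at most one natural number, so a near-constant index is
  constant.\<close>

lemma finite_cover_subbox:
  assumes "finite (I :: nat set)" and X: "\<And>i. i \<in> I \<Longrightarrow> X i \<in> S d" and ab: "nonempty_box d a b"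
    and cover: "Mbox a b \<subseteq> (\<Union>i\<in>I. X i)"
  obtains i a' b' where "i \<in> I" "subbox d a' b' a b" "Mbox a' b' \<subseteq> X i"
proof -
  let ?R = "{x @ [t] | x t. length x = d \<and> (\<exists>i\<in>I. x \<in> X i \<and> t = of_nat i)}"
  have R': "?R \<in> S (Suc d)"
  proof (rule S_I_snoc, rule dfn_bex_finite[OF assms(1)])
    fix i assume "i \<in> I"
    from X[OF this] have Xi: "X i \<in> S d" .
    show "dfn (\<lambda>s. map s [0..<d] \<in> X i \<and> s d = of_nat i)"
      by (rule definable_intros dfn_mem[OF Xi] | simp)+
  qed
  have ne: "\<exists>t. x @ [t] \<in> ?R" if x: "x \<in> Mbox a b" for x
    using Mbox_length[OF x] nonempty_box_length[OF ab] cover x unfolding snoc_mem by blast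
  have half: "(0::'m) < 1/2" by simp
  obtain a' b' p where sub: "subbox d a' b' a b"
    and p: "\<forall>x\<in>Mbox a' b'. \<exists>t. p \<le> t \<and> t \<le> p + 1/2 \<and> x @ [t] \<in> ?R"
    by (rule near_constD[OF near_const R' ab half ne]) (assumption | rule that)+
  note p = p[rule_format]
  have p': "\<exists>i\<in>I. x \<in> X i \<and> p \<le> of_nat i \<and> of_nat i \<le> p + 1/2" if "x \<in> Mbox a' b'" for x
    using p[OF that] unfolding snoc_mem by blast
  obtain x i where i: "i \<in> I" "p \<le> of_nat i" "of_nat i \<le> p + 1/2"
    using Mbox_nonempty[OF subbox_nonempty[OF sub]] p' by metis
  have eq: "j = i" if "p \<le> of_nat j" "of_nat j \<le> p + 1/2" for j
  proof -
    have "(of_nat j :: 'm) < of_nat i + 1" "(of_nat i :: 'm) < of_nat j + 1" using that i half by linarith+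
    then have "(of_nat j :: 'm) < of_nat (Suc i)" "(of_nat i :: 'm) < of_nat (Suc j)" by (simp_all add: add.commute)
    then show ?thesis unfolding of_nat_less_iff by simp
  qed
  have "Mbox a' b' \<subseteq> X i" using p' eq by blast
  then show ?thesis using that[OF i(1) sub] by blast
qed

text \<open>Treat the first entry of w by \<open>near_const\<close>, confine it to the interval
  found, and apply the induction hypothesis to the remaining entries over the smaller box.\<close>

lemma near_const_list:
  assumes "R \<in> S (d + m)" "nonempty_box d a b" and e: "0 < (\<epsilon>::'m)"
    and "\<And>x. x \<in> Mbox a b \<Longrightarrow> \<exists>w. length w = m \<and> x @ w \<in> R"
  shows "\<exists>a' b' p. subbox d a' b' a b \<and>
    (\<forall>x\<in>Mbox a' b'. \<exists>w. length w = m \<and> x @ w \<in> R \<and> (\<forall>i<m. p ! i \<le> w ! i \<and> w ! i \<le> p ! i + \<epsilon>))"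
  using assms(1,2,4)
proof (induction m arbitrary: R a b)
  case 0
  then show ?case using subbox_refl by fastforce
next
  case (Suc m)
  note R = Suc.prems(1) and ab = Suc.prems(2)
  let ?R1 = "{x @ [t] | x t. length x = d \<and> (\<exists>w. length w = m \<and> x @ t # w \<in> R)}"
  have R1: "?R1 \<in> S (Suc d)"
    by (rule S_I_snoc) (rule definable_intros dfn_mem[OF R] | simp)+
  have fib: "\<exists>t. x @ [t] \<in> ?R1" if x: "x \<in> Mbox a b" for x
  proof -
    obtain w where "length w = Suc m" "x @ w \<in> R" using Suc.prems(3)[OF x] by blast
    then show ?thesis using Mbox_length[OF x] nonempty_box_length[OF ab] unfolding snoc_mem
      by (auto simp: length_Suc_conv)
  qed
  obtain a1 b1 p where sub1: "subbox d a1 b1 a b"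
    and p: "\<forall>x\<in>Mbox a1 b1. \<exists>t. p \<le> t \<and> t \<le> p + \<epsilon> \<and> x @ [t] \<in> ?R1"
    by (rule near_constD[OF near_const R1 ab e fib]) (assumption | rule that)+
  note p = p[rule_format]
  let ?R2 = "{x @ w | x w. length x = d \<and> length w = m \<and> (\<exists>t. p \<le> t \<and> t \<le> p + \<epsilon> \<and> x @ t # w \<in> R)}"
  have R2: "?R2 \<in> S (d + m)"
    by (rule S_I_append) (rule definable_intros dfn_mem[OF R] | simp)+
  have "\<exists>w. length w = m \<and> x @ w \<in> ?R2" if x: "x \<in> Mbox a1 b1" for x
    using p[OF x] unfolding snoc_mem by blast
  from Suc.IH[OF R2 subbox_nonempty[OF sub1] this]
  obtain a2 b2 p' where sub2: "subbox d a2 b2 a1 b1" and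
    p': "\<And>x. x \<in> Mbox a2 b2 \<Longrightarrow> \<exists>w. length w = m \<and> x @ w \<in> ?R2 \<and> (\<forall>i<m. p' ! i \<le> w ! i \<and> w ! i \<le> p' ! i + \<epsilon>)"
    by blast
  note sub = subbox_trans[OF sub2 sub1]
  have "\<exists>w. length w = Suc m \<and> x @ w \<in> R \<and> (\<forall>i<Suc m. (p # p') ! i \<le> w ! i \<and> w ! i \<le> (p # p') ! i + \<epsilon>)"
    if x: "x \<in> Mbox a2 b2" for x
  proof -
    have lx: "length x = d" using Mbox_length[OF x] nonempty_box_length[OF subbox_nonempty[OF sub]] by simp
    obtain w where w: "length w = m" "x @ w \<in> ?R2" "\<forall>i<m. p' ! i \<le> w ! i \<and> w ! i \<le> p' ! i + \<epsilon>"
      using p'[OF x] by blast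
    obtain t where t: "p \<le> t" "t \<le> p + \<epsilon>" "x @ t # w \<in> R"
      using w(2) unfolding append_mem[OF lx] by blast
    show ?thesis
      by (intro exI[of _ "t # w"]) (use t w in \<open>auto simp: nth_Cons split: nat.splits\<close>)
  qed
  then show ?case using sub by blast
qed

text \<open>This replaces a point of continuity of a definable selection, without choosing a
  selection: by contradiction, a uniform failure on a box is incompatible with near-constant values
  there.\<close>

lemma locally_open_point:
  assumes R: "R \<in> S (d + m)" and ab: "nonempty_box d a b"
    and ne: "\<And>x. x \<in> Mbox a b \<Longrightarrow> \<exists>w. length w = m \<and> x @ w \<in> R"
  obtains x w where "x \<in> Mbox a b" "length w = m" "x @ w \<in> R"
    "\<And>\<epsilon>. 0 < \<epsilon> \<Longrightarrow> \<exists>c e. length c = d \<and> length e = d \<and> x \<in> Mbox c e \<and> (\<forall>y\<in>Mbox c e.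
       \<exists>w'. length w' = m \<and> y @ w' \<in> R \<and> (\<forall>i<m. w ! i - \<epsilon> < w' ! i \<and> w' ! i < w ! i + \<epsilon>))"
proof (rule ccontr)
  note result = that
  assume no: "\<not> thesis"
  define close where "close w \<epsilon> w' \<longleftrightarrow> (\<forall>i<m. w ! i - \<epsilon> < w' ! i \<and> w' ! i < w ! i + \<epsilon>)" for w w' and \<epsilon> :: 'm
  \<comment> \<open>The lengths are spelled out so that the quantifiers have the shape of
    \<open>dfn_ex_list\<close> and \<open>dfn_all_list\<close>.\<close>
  define good where "good x w \<epsilon> \<longleftrightarrow> (\<exists>c. length c = d \<and> (\<exists>e. length e = d \<and> (x \<in> Mbox c e \<and> (\<forall>y. length y = d \<longrightarrow> (y \<in> Mbox c e \<longrightarrow>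
       (\<exists>w'. length w' = m \<and> (y @ w' \<in> R \<and> close w \<epsilon> w')))))))" for x w \<epsilon>
  \<comment> \<open>Read contrapositively, failure at one scale persists at all smaller ones; this
    is the downward closure for \<open>uniform_lower_bound\<close>.\<close>
  have good_mono: "good x w \<epsilon>" if "good x w \<epsilon>'" "\<epsilon>' < \<epsilon>" for x w \<epsilon> \<epsilon>'
  proof -
    have "w ! i - \<epsilon> < w ! i - \<epsilon>'" "w ! i + \<epsilon>' < w ! i + \<epsilon>" for i
      using that(2) by simp_all
    then have "close w \<epsilon> w'" if "close w \<epsilon>' w'" for w'
      using that unfolding close_def by (meson less_trans)
    then show ?thesis using that(1) unfolding good_def by blast
  qed
  have bad: "\<exists>\<epsilon>>0. \<not> good x w \<epsilon>" if x: "x \<in> Mbox a b" "length w = m" "x @ w \<in> R" for x w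
  proof (rule ccontr)
    assume "\<not> ?thesis"
    then have g: "good x w \<epsilon>" if "0 < \<epsilon>" for \<epsilon> using that by blast
    have "\<exists>c e. length c = d \<and> length e = d \<and> x \<in> Mbox c e \<and> (\<forall>y\<in>Mbox c e.
       \<exists>w'. length w' = m \<and> y @ w' \<in> R \<and> (\<forall>i<m. w ! i - \<epsilon> < w' ! i \<and> w' ! i < w ! i + \<epsilon>))" if e: "0 < \<epsilon>" for \<epsilon>
    proof -
      obtain c e where ce: "length c = d" "length e = d" "x \<in> Mbox c e"
        "\<forall>y. length y = d \<longrightarrow> (y \<in> Mbox c e \<longrightarrow>
          (\<exists>w'. length w' = m \<and> (y @ w' \<in> R \<and> (\<forall>i<m. w ! i - \<epsilon> < w' ! i \<and> w' ! i < w ! i + \<epsilon>))))"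
        using g[OF e] unfolding good_def close_def by blast
      have "length y = d" if "y \<in> Mbox c e" for y using Mbox_length[OF that] ce(1) by simp
      with ce show ?thesis by blast
    qed
    then have thesis by (rule result[OF x])
    then show False using no by contradiction
  qed
  let ?T = "{x @ [\<epsilon>] | x \<epsilon>. length x = d \<and> (0 < \<epsilon> \<and> (\<exists>w. length w = m \<and> (x @ w \<in> R \<and> \<not> good x w \<epsilon>)))}"
  have T: "?T \<in> S (Suc d)" unfolding good_def close_def
    by (rule S_I_snoc) (rule definable_intros dfn_mem[OF R] | simp)+
  have lx: "length x = d" if "x \<in> Mbox a b" for x
    using Mbox_length[OF that] nonempty_box_length[OF ab] by simp
  have neT: "\<exists>\<epsilon>>0. x @ [\<epsilon>] \<in> ?T" if x: "x \<in> Mbox a b" for x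
  proof -
    obtain w where w: "length w = m" "x @ w \<in> R" using ne[OF x] by blast
    obtain \<epsilon> where "0 < \<epsilon>" "\<not> good x w \<epsilon>" using bad[OF x w] by blast
    then show ?thesis using w lx[OF x] unfolding snoc_mem by blast
  qed
  have downT: "x @ [\<epsilon>'] \<in> ?T" if "x \<in> Mbox a b" "x @ [\<epsilon>] \<in> ?T" "0 < \<epsilon>'" "\<epsilon>' < \<epsilon>" for x \<epsilon> \<epsilon>'
    using that(2,3) good_mono[OF _ that(4)] unfolding snoc_mem by blast
  obtain a1 b1 \<epsilon> where sub1: "subbox d a1 b1 a b" "0 < \<epsilon>" and e: "\<forall>x\<in>Mbox a1 b1. x @ [\<epsilon>] \<in> ?T"
    by (rule uniform_lower_bound[OF near_const T ab neT downT]) (assumption | rule that)+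
  \<comment> \<open>Near-constancy is applied to the failing pairs only, so that the selected w is
    itself bad at the uniform scale.\<close>
  let ?R = "{x @ w | x w. length x = d \<and> length w = m \<and> (x @ w \<in> R \<and> \<not> good x w \<epsilon>)}"
  have R': "?R \<in> S (d + m)" unfolding good_def close_def
    by (rule S_I_append) (rule definable_intros dfn_mem[OF R] | simp)+
  have "\<exists>w. length w = m \<and> x @ w \<in> ?R" if x: "x \<in> Mbox a1 b1" for x
    using e[rule_format, OF x] unfolding snoc_mem by blast
  moreover have "0 < \<epsilon>/2" using sub1 by simp
  ultimately obtain a2 b2 p where sub2: "subbox d a2 b2 a1 b1"
    and p: "\<forall>x\<in>Mbox a2 b2. \<exists>w. length w = m \<and> x @ w \<in> ?R \<and> (\<forall>i<m. p ! i \<le> w ! i \<and> w ! i \<le> p ! i + \<epsilon>/2)"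
    using near_const_list[OF R' subbox_nonempty[OF sub1(1)], of "\<epsilon>/2"] by blast
  note len2 = nonempty_box_length[OF subbox_nonempty[OF sub2]]
  have l2: "length x = d" if "x \<in> Mbox a2 b2" for x using Mbox_length[OF that] len2 by simp
  obtain x where x: "x \<in> Mbox a2 b2" using Mbox_nonempty[OF subbox_nonempty[OF sub2]] by blast
  have p': "\<exists>w. length w = m \<and> x @ w \<in> R \<and> \<not> good x w \<epsilon> \<and> (\<forall>i<m. p ! i \<le> w ! i \<and> w ! i \<le> p ! i + \<epsilon>/2)"
    if x: "x \<in> Mbox a2 b2" for x
    using p[rule_format, OF x] unfolding append_mem[OF l2[OF x]] by blast
  obtain w where w: "length w = m" "\<not> good x w \<epsilon>" "\<forall>i<m. p ! i \<le> w ! i \<and> w ! i \<le> p ! i + \<epsilon>/2"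
    using p'[OF x] by blast
  \<comment> \<open>All selected values lie in one cube of side \<epsilon>/2, so the box from
    \<open>a2\<close> to \<open>b2\<close> itself witnesses
    \<open>good x w \<epsilon>\<close>.\<close>
  have "\<exists>w'. length w' = m \<and> (y @ w' \<in> R \<and> close w \<epsilon> w')"
    if y: "y \<in> Mbox a2 b2" for y
  proof -
    obtain w' where w': "length w' = m" "y @ w' \<in> R" "\<forall>i<m. p ! i \<le> w' ! i \<and> w' ! i \<le> p ! i + \<epsilon>/2"
      using p'[OF y] by blast
    have half: "\<epsilon>/2 < \<epsilon>" using sub1 by simp
    have "w ! i - \<epsilon> < w' ! i \<and> w' ! i < w ! i + \<epsilon>" if "i < m" for i
    proof -
      have "p ! i \<le> w ! i" "w ! i \<le> p ! i + \<epsilon>/2" "p ! i \<le> w' ! i" "w' ! i \<le> p ! i + \<epsilon>/2"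
        using w(3) w'(3) that by blast+
      then show ?thesis using half by linarith
    qed
    then show ?thesis using w' unfolding close_def by blast
  qed
  then have "good x w \<epsilon>" unfolding good_def using len2 x by blast
  then show False using w(2) by contradiction
qed

end

section \<open>Charts and the orbit map\<close>

text \<open>The generating boxes are a base and not just a subbase: two boxes meet in the box with
  the larger lower and the smaller upper corners.\<close>

lemma openin_Mtop_box:
  assumes "openin (Mtop d) W" "x \<in> W"
  obtains a b where "length a = d" "length b = d" "x \<in> Mbox a b" "Mbox a b \<subseteq> W"
proof -
  have "generate_topology_on {Mbox a b | a b. length a = d \<and> length b = d} W"
    using assms(1) by (simp add: Mtop_def openin_topology_generated_by_iff)
  then have "\<exists>a b. length a = d \<and> length b = d \<and> x \<in> Mbox a b \<and> Mbox a b \<subseteq> W"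
    using assms(2)
  proof (induction arbitrary: x)
    case Empty
    then show ?case by simp
  next
    case (Int A B)
    obtain a b where ab: "length a = d" "length b = d" "x \<in> Mbox a b" "Mbox a b \<subseteq> A"
      using Int.IH(1)[of x] Int.prems by blast
    obtain a' b' where ab': "length a' = d" "length b' = d" "x \<in> Mbox a' b'" "Mbox a' b' \<subseteq> B"
      using Int.IH(2)[of x] Int.prems by blast
    define c where "c = map2 max a a'"
    define e where "e = map2 min b b'"
    have "Mbox c e = Mbox a b \<inter> Mbox a' b'"
      using ab ab' by (auto simp: Mbox_def c_def e_def)
    moreover have "length c = d" "length e = d" using ab ab' by (auto simp: c_def e_def)
    ultimately show ?case using ab ab' by blast
  next
    case (UN K)
    then obtain k where k: "k \<in> K" "x \<in> k" by blast
    show ?case using UN.IH[OF k] k(1) by blast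
  next
    case (Basis s)
    then show ?case by blast
  qed
  then show ?thesis using that by blast
qed

lemma openin_Mtop_Mbox: "length a = d \<Longrightarrow> length b = d \<Longrightarrow> openin (Mtop d) (Mbox a b)"
  unfolding Mtop_def by (rule topology_generated_by_Basis) blast

lemma openin_Mtop_eps:
  fixes W :: "'m::linordered_field list set"
  assumes "openin (Mtop d) W" "w \<in> W"
  obtains \<epsilon> where "0 < \<epsilon>" "\<And>w'. length w' = d \<Longrightarrow> \<forall>i<d. w ! i - \<epsilon> < w' ! i \<and> w' ! i < w ! i + \<epsilon> \<Longrightarrow> w' \<in> W"
proof -
  obtain a b where ab: "length a = d" "length b = d" "w \<in> Mbox a b" "Mbox a b \<subseteq> W"
    using openin_Mtop_box[OF assms] by blast
  \<comment> \<open>The entry 1 keeps \<open>E\<close> nonempty when d = 0.\<close>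
  define E where "E = insert 1 ((\<lambda>i. w ! i - a ! i) ` {..<d} \<union> (\<lambda>i. b ! i - w ! i) ` {..<d})"
  have "finite E" "E \<noteq> {}" by (auto simp: E_def)
  moreover have "\<forall>t\<in>E. 0 < t" using ab by (auto simp: E_def Mbox_def)
  ultimately have "0 < Min E" by simp
  moreover have "w' \<in> W" if w': "length w' = d" "\<forall>i<d. w ! i - Min E < w' ! i \<and> w' ! i < w ! i + Min E" for w'
  proof -
    have "a ! i < w' ! i \<and> w' ! i < b ! i" if i: "i < d" for i
    proof -
      have "Min E \<le> w ! i - a ! i" "Min E \<le> b ! i - w ! i"
        using i by (auto intro!: Min_le simp: E_def)
      moreover have "w ! i - Min E < w' ! i \<and> w' ! i < w ! i + Min E" using w' i by blast
      ultimately show ?thesis by (auto simp: algebra_simps intro: less_le_trans le_less_trans)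
    qed
    then have "w' \<in> Mbox a b" using ab w' by (simp add: Mbox_def)
    then show ?thesis using ab by blast
  qed
  ultimately show ?thesis using that by blast
qed

text \<open>The common length n makes the splitting of the concatenation unique.\<close>

lemma mem_graph:
  assumes "\<And>z. z \<in> A \<Longrightarrow> length z = n" "length y = n"
  shows "y @ x \<in> {z @ f z | z. z \<in> A} \<longleftrightarrow> y \<in> A \<and> x = f y"
proof
  assume "y @ x \<in> {z @ f z | z. z \<in> A}"
  then obtain z where z: "z \<in> A" "y @ x = z @ f z" by blast
  then have "y = z \<and> x = f z" using assms(1)[OF z(1)] assms(2) by (intro append_eq_append_conv[THEN iffD1]) simp_all
  then show "y \<in> A \<and> x = f y" using z by simp
qed blast

text \<open>U and W are open, so sets open in the subspaces are open in X and Y; the chart can then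
  be used without mentioning subspaces.\<close>

lemma homeomorphic_chart:
  assumes "openin X U" "openin Y W" "homeomorphic_map (subtopology X U) (subtopology Y W) f"
  shows "f ` U = W" "inj_on f U" "\<And>N. openin X N \<Longrightarrow> openin Y (f ` (N \<inter> U))"
    "\<And>N. openin Y N \<Longrightarrow> openin X {x \<in> U. f x \<in> N}"
proof -
  have top: "topspace (subtopology X U) = U" "topspace (subtopology Y W) = W"
    using assms(1,2) openin_subset by (auto simp: topspace_subtopology)
  show im: "f ` U = W" using homeomorphic_imp_surjective_map[OF assms(3)] top by simp
  show "inj_on f U" using homeomorphic_imp_injective_map[OF assms(3)] top by simp
  show "openin Y (f ` (N \<inter> U))" if "openin X N" for N
  proof -
    have "openin (subtopology X U) (N \<inter> U)" using that by (auto simp: openin_subtopology)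
    then have "openin (subtopology Y W) (f ` (N \<inter> U))"
      using homeomorphic_imp_open_map[OF assms(3)] by (simp add: open_map_def)
    then show ?thesis using assms(2) openin_trans_full by blast
  qed
  show "openin X {x \<in> U. f x \<in> N}" if "openin Y N" for N
  proof -
    have "openin (subtopology Y W) (N \<inter> W)" using that by (auto simp: openin_subtopology)
    from openin_continuous_map_preimage[OF homeomorphic_imp_continuous_map[OF assms(3)] this]
    have "openin (subtopology X U) {x \<in> U. f x \<in> N \<inter> W}" by (simp only: top)
    moreover have "{x \<in> U. f x \<in> N \<inter> W} = {x \<in> U. f x \<in> N}" using im by blast
    ultimately show ?thesis using assms(1) openin_trans_full by fastforce
  qed
qed

section \<open>Homogeneity of the action\<close>

text \<open>The orbit map intertwines left translation on G with the action on V, and both act by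
  homeomorphisms. Openness at g0 is thus carried to every g by the element that takes g to
  g0.\<close>

lemma orbit_map_open_if_open_at_point:
  assumes "group (grp G gmul e)"
    and TG: "topspace TG = G" "continuous_map (prod_topology TG TG) TG (\<lambda>(g, h). gmul g h)"
    and \<tau>: "topspace \<tau> = V" "continuous_map (prod_topology TG \<tau>) \<tau> (\<lambda>(g, x). \<alpha> g x)"
    and act: "\<And>g x. g \<in> G \<Longrightarrow> x \<in> V \<Longrightarrow> \<alpha> g x \<in> V" "\<And>x. x \<in> V \<Longrightarrow> \<alpha> e x = x"
      "\<And>g h x. g \<in> G \<Longrightarrow> h \<in> G \<Longrightarrow> x \<in> V \<Longrightarrow> \<alpha> (gmul g h) x = \<alpha> g (\<alpha> h x)"
    and v: "v \<in> V" and g0: "g0 \<in> G"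
    and at: "\<And>U. openin TG U \<Longrightarrow> g0 \<in> U \<Longrightarrow> \<exists>N. openin \<tau> N \<and> \<alpha> g0 v \<in> N \<and> N \<subseteq> (\<lambda>g. \<alpha> g v) ` U"
  shows "open_map TG \<tau> (\<lambda>g. \<alpha> g v)"
  unfolding open_map_def
proof (intro allI impI)
  interpret group "grp G gmul e" by fact
  let ?inv = "\<lambda>g. inv\<^bsub>grp G gmul e\<^esub> g"
  have grp: "gmul g h \<in> G" "?inv g \<in> G" "gmul (?inv g) g = e" "gmul g (?inv g) = e"
    "gmul e g = g" "gmul g e = g" if "g \<in> G" "h \<in> G" for g h
    using that m_closed[of g h] inv_closed[of g] l_inv[of g] r_inv[of g] l_one[of g] r_one[of g] by (simp_all add: grp_def)
  have assoc: "gmul (gmul g h) k = gmul g (gmul h k)" if "g \<in> G" "h \<in> G" "k \<in> G" for g h k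
    using that m_assoc[of g h k] by (simp add: grp_def)
  fix U assume U: "openin TG U"
  have UG: "U \<subseteq> G" using openin_subset[OF U] TG by simp
  show "openin \<tau> ((\<lambda>g. \<alpha> g v) ` U)"
    unfolding openin_subopen[of \<tau> "(\<lambda>g. \<alpha> g v) ` U"]
  proof
    fix y assume "y \<in> (\<lambda>g. \<alpha> g v) ` U"
    then obtain g where g: "g \<in> U" "y = \<alpha> g v" by blast
    then have gG: "g \<in> G" using UG by blast
    define h where "h = gmul g0 (?inv g)"
    have h: "h \<in> G" using grp gG g0 by (simp add: h_def)
    have hg: "gmul h g = g0" using grp gG g0 by (simp add: h_def assoc)
    have hh: "gmul (?inv h) (gmul h k) = k" if "k \<in> G" for k
      using that h grp by (simp flip: assoc)
    have hh': "gmul h (gmul (?inv h) k) = k" if "k \<in> G" for k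
      using that h grp by (simp flip: assoc)
    have left: "continuous_map TG TG (gmul k)" if "k \<in> G" for k
    proof -
      have "continuous_map TG (prod_topology TG TG) (\<lambda>x. (k, x))"
        using that TG(1) by (intro continuous_map_pairedI) auto
      from continuous_map_compose[OF this TG(2)] show ?thesis by (simp add: o_def)
    qed
    have leftV: "continuous_map \<tau> \<tau> (\<alpha> h)"
    proof -
      have "continuous_map \<tau> (prod_topology TG \<tau>) (\<lambda>x. (h, x))"
        using h TG(1) by (intro continuous_map_pairedI) auto
      from continuous_map_compose[OF this \<tau>(2)] show ?thesis by (simp add: o_def)
    qed
    \<comment> \<open>The translate of U by \<open>h\<close>, written as a preimage under left
      multiplication by the inverse, so that continuity gives its openness.\<close>
    define U' where "U' = {k \<in> G. gmul (?inv h) k \<in> U}"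
    have "openin TG U'"
      unfolding U'_def using openin_continuous_map_preimage[OF left U, of "?inv h"] h grp TG by simp
    moreover have "g0 \<in> U'" unfolding U'_def using hg[symmetric] hh[OF gG] g0 g by simp
    ultimately obtain N where N: "openin \<tau> N" "\<alpha> g0 v \<in> N" "N \<subseteq> (\<lambda>g. \<alpha> g v) ` U'"
      using at by blast
    \<comment> \<open>N pulled back by the action of \<open>h\<close>; it is a neighbourhood of y
      because \<open>h\<close> moves y to \<alpha> g0 v.\<close>
    let ?T = "{x \<in> V. \<alpha> h x \<in> N}"
    have "openin \<tau> ?T" using openin_continuous_map_preimage[OF leftV N(1)] \<tau> by simp
    moreover have "y \<in> ?T" using N(2) hg act v gG h g by (metis (mono_tags, lifting) mem_Collect_eq)
    moreover have "?T \<subseteq> (\<lambda>g. \<alpha> g v) ` U"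
    proof
      fix x assume x: "x \<in> ?T"
      then obtain k where k: "k \<in> U'" "\<alpha> h x = \<alpha> k v" using N(3) by auto
      have kG: "k \<in> G" "gmul (?inv h) k \<in> U" using k by (auto simp: U'_def)
      have ih: "?inv h \<in> G" using grp h by blast
      have "x = \<alpha> (?inv h) (\<alpha> h x)" using act(2,3) x h ih grp by (metis (mono_tags, lifting) mem_Collect_eq)
      also have "\<dots> = \<alpha> (gmul (?inv h) k) v" using k act(3)[OF ih kG(1) v] by simp
      finally show "x \<in> (\<lambda>g. \<alpha> g v) ` U" using kG by blast
    qed
    ultimately show "\<exists>T. openin \<tau> T \<and> y \<in> T \<and> T \<subseteq> (\<lambda>g. \<alpha> g v) ` U" by blast
  qed
qed

section \<open>The orbit relation in charts and openness of the orbit map\<close>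

theorem theorem4p4:
  fixes S :: "nat \<Rightarrow> 'm::linordered_field list set set"
    and n k :: nat
    and G V :: "'m list set"
    and gmul :: "'m list \<Rightarrow> 'm list \<Rightarrow> 'm list" and e :: "'m list"
    and TG \<tau> :: "'m list topology"
    and \<alpha> :: "'m list \<Rightarrow> 'm list \<Rightarrow> 'm list"
    and v :: "'m list"
  assumes "real_closed_field TYPE('m)"
    and "o_minimal_expansion S"
    and "def_group S n G gmul e"
    and "def_group_topology S n G gmul e TG"
    and "def_transitive_action S n k G gmul e V \<alpha>"
    and "\<exists>d. def_manifold S k \<tau> V d"
    and "continuous_map (prod_topology TG \<tau>) \<tau> (\<lambda>(g, x). \<alpha> g x)"
    and "v \<in> V"
  shows "open_map TG \<tau> (\<lambda>g. \<alpha> g v)"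
proof -
  interpret o_minimal S by unfold_locales (rule assms(2))
  obtain d' where "def_manifold S n TG G d'"
    using assms(4) unfolding def_group_topology_def by blast
  then obtain I' U' W' \<psi> where TG: "topspace TG = G" and I': "finite (I' :: nat set)" "G = (\<Union>i\<in>I'. U' i)"
    and c': "\<forall>i\<in>I'. openin TG (U' i) \<and> U' i \<in> S n \<and> W' i \<in> S d' \<and> openin (Mtop d') (W' i) \<and>
      def_map S n d' (U' i) (\<psi> i) \<and> homeomorphic_map (subtopology TG (U' i)) (subtopology (Mtop d') (W' i)) (\<psi> i)"
    unfolding def_manifold_def by (elim conjE exE) (rule that)
  note chart' = bspec[OF c']
  obtain d where "def_manifold S k \<tau> V d" using assms(6) by blast
  then obtain I U W \<phi> where \<tau>: "topspace \<tau> = V" and I: "finite (I :: nat set)" "V = (\<Union>i\<in>I. U i)"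
    and c: "\<forall>i\<in>I. openin \<tau> (U i) \<and> U i \<in> S k \<and> W i \<in> S d \<and> openin (Mtop d) (W i) \<and>
      def_map S k d (U i) (\<phi> i) \<and> homeomorphic_map (subtopology \<tau> (U i)) (subtopology (Mtop d) (W i)) (\<phi> i)"
    unfolding def_manifold_def by (elim conjE exE) (rule that)
  note chart = bspec[OF c]
  have GS: "G \<in> S n" and grp: "group (grp G gmul e)"
    using assms(3) by (auto simp: def_group_def)
  have VS: "V \<in> S k" and act: "\<And>g x. g \<in> G \<Longrightarrow> x \<in> V \<Longrightarrow> \<alpha> g x \<in> V" "\<And>x. x \<in> V \<Longrightarrow> \<alpha> e x = x"
      "\<And>g h x. g \<in> G \<Longrightarrow> h \<in> G \<Longrightarrow> x \<in> V \<Longrightarrow> \<alpha> (gmul g h) x = \<alpha> g (\<alpha> h x)"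
    and trans: "\<And>x y. x \<in> V \<Longrightarrow> y \<in> V \<Longrightarrow> \<exists>g\<in>G. \<alpha> g x = y"
    and act_dfn: "def_map S (n + k) k {g @ x | g x. g \<in> G \<and> x \<in> V} (\<lambda>xs. \<alpha> (take n xs) (drop n xs))"
    using assms(5) unfolding def_transitive_action_def by blast+
  obtain j where j: "j \<in> I" "v \<in> U j" using assms(8) I(2) by blast
  have Uj: "openin \<tau> (U j)" "U j \<in> S k" "openin (Mtop d) (W j)" "def_map S k d (U j) (\<phi> j)"
    "homeomorphic_map (subtopology \<tau> (U j)) (subtopology (Mtop d) (W j)) (\<phi> j)"
    using chart[OF j(1)] by blast+
  note hom = homeomorphic_chart[OF Uj(1,3,5)]
  obtain a b where ab: "length a = d" "length b = d" "\<phi> j v \<in> Mbox a b" "Mbox a b \<subseteq> W j"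
    by (rule openin_Mtop_box[OF Uj(3)]) (use hom(1) j(2) in \<open>auto\<close>)
  have box: "nonempty_box d a b"
    using ab(1-3) by (auto simp: nonempty_box_def list_all2_conv_all_nth Mbox_def intro: less_trans)

  \<comment> \<open>The graphs of the chart of V around v, of the charts of G, and of the action;
    all are definable by \<open>def_map\<close>.\<close>
  define \<Phi> where "\<Phi> = {y @ \<phi> j y | y. y \<in> U j}"
  define \<Psi> where "\<Psi> i = {g @ \<psi> i g | g. g \<in> U' i}" for i
  define A where "A = {xs @ \<alpha> (take n xs) (drop n xs) | xs. xs \<in> {g @ x | g x. g \<in> G \<and> x \<in> V}}"
  have \<Phi>S: "\<Phi> \<in> S (k + d)" using Uj(4) by (simp add: def_map_def \<Phi>_def)
  have \<Psi>S: "\<Psi> i \<in> S (n + d')" if "i \<in> I'" for i using chart'[OF that] by (simp add: def_map_def \<Psi>_def)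
  have AS: "A \<in> S (n + k + k)" using act_dfn by (simp only: def_map_def A_def)
  have lv: "length v = k" by (rule S_length[OF VS assms(8)])
  \<comment> \<open>The inverse of the orbit map in coordinates: w represents, in chart i of G, an
    element that sends v to the point with coordinate x. This form shows definability; the next fact
    gives the meaning.\<close>
  define rel where "rel i x w \<longleftrightarrow> (\<exists>y. length y = k \<and> (\<exists>g. length g = n \<and>
      (y @ x \<in> \<Phi> \<and> g @ w \<in> \<Psi> i \<and> (g @ v) @ y \<in> A)))" for i x w
  have rel: "rel i x w \<longleftrightarrow> (\<exists>y\<in>U j. \<exists>g\<in>U' i. x = \<phi> j y \<and> w = \<psi> i g \<and> y = \<alpha> g v)" if i: "i \<in> I'" for i x w
  proof -
    have U'i: "U' i \<in> S n" "U' i \<subseteq> G" using chart'[OF i] I'(2) i by auto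
    have 1: "y @ x \<in> \<Phi> \<longleftrightarrow> y \<in> U j \<and> x = \<phi> j y" if "length y = k" for y
      unfolding \<Phi>_def by (rule mem_graph[OF S_length[OF Uj(2)] that])
    have 2: "g @ w \<in> \<Psi> i \<longleftrightarrow> g \<in> U' i \<and> w = \<psi> i g" if "length g = n" for g
      unfolding \<Psi>_def by (rule mem_graph[OF S_length[OF U'i(1)] that])
    have 3: "(g @ v) @ y \<in> A \<longleftrightarrow> y = \<alpha> g v" if g: "g \<in> G" for g y
    proof -
      have lg: "length g = n" by (rule S_length[OF GS g])
      have dom: "{g @ x | g x. g \<in> G \<and> x \<in> V} \<in> S (n + k)" using act_dfn by (simp only: def_map_def)
      have "(g @ v) @ y \<in> A \<longleftrightarrow> g @ v \<in> {g @ x | g x. g \<in> G \<and> x \<in> V} \<and> y = \<alpha> (take n (g @ v)) (drop n (g @ v))"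
        unfolding A_def by (rule mem_graph[OF S_length[OF dom]]) (simp_all add: lg lv)
      moreover have "g @ v \<in> {g @ x | g x. g \<in> G \<and> x \<in> V}" using g assms(8) by blast
      ultimately show ?thesis by (simp add: lg)
    qed
    show ?thesis
    proof
      assume "rel i x w"
      then obtain y g where "length y = k" "length g = n" "y @ x \<in> \<Phi>" "g @ w \<in> \<Psi> i" "(g @ v) @ y \<in> A"
        unfolding rel_def by blast
      then show "\<exists>y\<in>U j. \<exists>g\<in>U' i. x = \<phi> j y \<and> w = \<psi> i g \<and> y = \<alpha> g v"
        using 1 2 3 U'i(2) by blast
    next
      assume "\<exists>y\<in>U j. \<exists>g\<in>U' i. x = \<phi> j y \<and> w = \<psi> i g \<and> y = \<alpha> g v"
      then obtain y g where yg: "y \<in> U j" "g \<in> U' i" "x = \<phi> j y" "w = \<psi> i g" "y = \<alpha> g v" by blast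
      have l: "length y = k" "length g = n" by (rule S_length[OF Uj(2) yg(1)], rule S_length[OF U'i(1) yg(2)])
      have "y @ x \<in> \<Phi>" "g @ w \<in> \<Psi> i" using 1[OF l(1)] 2[OF l(2)] yg(1-4) by blast+
      moreover have "g \<in> G" using yg(2) U'i(2) by blast
      from 3[OF this] have "(g @ v) @ y \<in> A" using yg(5) by blast
      ultimately show "rel i x w" unfolding rel_def using l by blast
    qed
  qed
  have lw: "length (\<psi> i g) = d'" if "i \<in> I'" "g \<in> U' i" for i g
    using chart'[OF that(1)] that(2) by (simp add: def_map_def Mn_def)

  define X where "X i = {x. length x = d \<and> (\<exists>w. length w = d' \<and> rel i x w)}" for i
  have XS: "X i \<in> S d" if i: "i \<in> I'" for i
    unfolding X_def rel_def
    by (rule S_I) (rule definable_intros dfn_mem[OF \<Phi>S] dfn_mem[OF \<Psi>S[OF i]] dfn_mem[OF AS] | simp add: lv)+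
  \<comment> \<open>Transitivity enters here: every point of the chart is \<alpha> g v for some g,
    and g lies in some chart of G.\<close>
  have cover: "Mbox a b \<subseteq> (\<Union>i\<in>I'. X i)"
  proof
    fix x assume x: "x \<in> Mbox a b"
    then obtain y where y: "y \<in> U j" "x = \<phi> j y" using ab(4) hom(1) by blast
    then have "y \<in> V" using I(2) j(1) by blast
    then obtain g where g: "g \<in> G" "\<alpha> g v = y" using trans[OF assms(8)] by blast
    then obtain i where i: "i \<in> I'" "g \<in> U' i" using I'(2) by blast
    have "rel i x (\<psi> i g)" unfolding rel[OF i(1)] using y g i by blast
    then have "x \<in> X i" using lw[OF i] Mbox_length[OF x] ab(1) unfolding X_def by blast
    then show "x \<in> (\<Union>i\<in>I'. X i)" using i by blast
  qed
  \<comment> \<open>A single chart of G now serves a whole box, so the relation has fibres in one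
    fixed power of M.\<close>
  obtain i a1 b1 where i: "i \<in> I'" and sub: "subbox d a1 b1 a b" "Mbox a1 b1 \<subseteq> X i"
    by (rule finite_cover_subbox[OF I'(1) XS box cover]) (assumption | rule that)+
  let ?R = "{x @ w | x w. length x = d \<and> length w = d' \<and> rel i x w}"
  have RS: "?R \<in> S (d + d')"
    unfolding rel_def
    by (rule S_I_append) (rule definable_intros dfn_mem[OF \<Phi>S] dfn_mem[OF \<Psi>S[OF i]] dfn_mem[OF AS] | simp add: lv)+
  have mem: "x @ w \<in> ?R \<longleftrightarrow> length w = d' \<and> rel i x w" if "length x = d" for x w
    by (rule append_mem[OF that])
  have fib: "\<exists>w. length w = d' \<and> x @ w \<in> ?R" if x: "x \<in> Mbox a1 b1" for x
  proof -
    have "x \<in> X i" using x sub(2) by blast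
    then have lx: "length x = d" and "\<exists>w. length w = d' \<and> rel i x w" by (auto simp: X_def)
    then show ?thesis unfolding mem[OF lx] by blast
  qed
  obtain x0 w0 where x0: "x0 \<in> Mbox a1 b1" "x0 @ w0 \<in> ?R" and
    loc: "\<And>\<epsilon>. 0 < \<epsilon> \<Longrightarrow> \<exists>c e. length c = d \<and> length e = d \<and> x0 \<in> Mbox c e \<and> (\<forall>y\<in>Mbox c e.
       \<exists>w'. length w' = d' \<and> y @ w' \<in> ?R \<and> (\<forall>i<d'. w0 ! i - \<epsilon> < w' ! i \<and> w' ! i < w0 ! i + \<epsilon>))"
    by (rule locally_open_point[OF RS subbox_nonempty[OF sub(1)] fib]) (assumption | rule that)+
  have lx0: "length x0 = d"
    using Mbox_length[OF x0(1)] nonempty_box_length[OF subbox_nonempty[OF sub(1)]] by simp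
  have "rel i x0 w0" using x0(2) unfolding mem[OF lx0] by blast
  \<comment> \<open>The element \<open>g0\<close> behind the point of local openness is where the
    orbit map is shown to be open.\<close>
  then obtain y0 g0 where y0: "y0 \<in> U j" "g0 \<in> U' i" "x0 = \<phi> j y0" "w0 = \<psi> i g0" "y0 = \<alpha> g0 v"
    unfolding rel[OF i] by blast
  have U'i: "openin TG (U' i)" "openin (Mtop d') (W' i)"
    "homeomorphic_map (subtopology TG (U' i)) (subtopology (Mtop d') (W' i)) (\<psi> i)"
    using chart'[OF i] by blast+
  note hom' = homeomorphic_chart[OF U'i]
  have g0: "g0 \<in> G" using y0(2) i I'(2) by blast

  show ?thesis
  proof (rule orbit_map_open_if_open_at_point[OF grp TG _ \<tau> assms(7) act assms(8) g0])
    show "continuous_map (prod_topology TG TG) TG (\<lambda>(g, h). gmul g h)"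
      using assms(4) by (simp add: def_group_topology_def)
    fix O' assume O': "openin TG O'" "g0 \<in> O'"
    have op: "openin (Mtop d') (\<psi> i ` (O' \<inter> U' i))" by (rule hom'(3)[OF O'(1)])
    have w0: "w0 \<in> \<psi> i ` (O' \<inter> U' i)" using y0 O'(2) by blast
    \<comment> \<open>The chart image of the given neighbourhood of \<open>g0\<close> contains a
      cube around \<open>w0\<close>; its size is the scale for \<open>loc\<close>.\<close>
    obtain \<epsilon> where \<epsilon>: "0 < \<epsilon>"
      "\<And>w'. length w' = d' \<Longrightarrow> \<forall>i<d'. w0 ! i - \<epsilon> < w' ! i \<and> w' ! i < w0 ! i + \<epsilon> \<Longrightarrow> w' \<in> \<psi> i ` (O' \<inter> U' i)"
      using openin_Mtop_eps[OF op w0] by blast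
    obtain c e where ce: "length c = d" "length e = d" "x0 \<in> Mbox c e" and
      near: "\<forall>y\<in>Mbox c e. \<exists>w'. length w' = d' \<and> y @ w' \<in> ?R \<and> (\<forall>i<d'. w0 ! i - \<epsilon> < w' ! i \<and> w' ! i < w0 ! i + \<epsilon>)"
      using loc[OF \<epsilon>(1)] by (elim exE conjE) (rule that)
    let ?N = "{y \<in> U j. \<phi> j y \<in> Mbox c e}"
    have "openin \<tau> ?N" by (rule hom(4)[OF openin_Mtop_Mbox[OF ce(1,2)]])
    moreover have "\<alpha> g0 v \<in> ?N" using y0 ce(3) by simp
    moreover have "?N \<subseteq> (\<lambda>g. \<alpha> g v) ` O'"
    proof
      fix y assume "y \<in> ?N"
      then have y: "y \<in> U j" "\<phi> j y \<in> Mbox c e" by auto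
      obtain w' where w': "length w' = d'" "\<phi> j y @ w' \<in> ?R" "\<forall>i<d'. w0 ! i - \<epsilon> < w' ! i \<and> w' ! i < w0 ! i + \<epsilon>"
        using bspec[OF near y(2)] by (elim exE conjE) (rule that)
      have "length (\<phi> j y) = d" using Mbox_length[OF y(2)] ce(1) by simp
      from w'(2)[unfolded mem[OF this]] have "rel i (\<phi> j y) w'" by blast
      then obtain y' g where g: "y' \<in> U j" "g \<in> U' i" "\<phi> j y = \<phi> j y'" "w' = \<psi> i g" "y' = \<alpha> g v"
        unfolding rel[OF i] by blast
      \<comment> \<open>The relation speaks about coordinates only. Injectivity of the two charts
        identifies \<open>y'\<close> with y, and g with a member of the given neighbourhood.\<close>
      have "y = y'" using inj_onD[OF hom(2) g(3) y(1) g(1)] .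
      obtain g' where g': "g' \<in> O'" "g' \<in> U' i" "w' = \<psi> i g'" using \<epsilon>(2)[OF w'(1,3)] by blast
      have "g = g'" using inj_onD[OF hom'(2) _ g(2) g'(2)] g(4) g'(3) by simp
      then show "y \<in> (\<lambda>g. \<alpha> g v) ` O'" using \<open>y = y'\<close> g(5) g'(1) by blast
    qed
    ultimately show "\<exists>N. openin \<tau> N \<and> \<alpha> g0 v \<in> N \<and> N \<subseteq> (\<lambda>g. \<alpha> g v) ` O'" by blast
  qed
qed

end
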